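(* Let $X\subset\mathbb{P}^4$ be a quintic threefold whose equation, up to a coordinate transformation, is of the form $x_0x_1q_3(x_2,x_3,x_4)$. (1) If $X$ belongs to the family US1-VIII, then $X$ is unstable. (2) If $X$ is of type SS1-VIII, then its orbit is not closed and it degenerates to MO2-IV. (3) If $X$ is of type SS2-VIII, then its orbit is not closed and it degenerates to MO2-IV. Otherwise, $X$ has a closed orbit.
   Context: Conventions. $SL(5,\mathbb{C})$ acts on the space $V$ of quintic forms in $x_0,\dots,x_4$ by change of coordinates. "Orbit" means the $SL(5,\mathbb{C})$-orbit in $V$ of the equation of $X$. Unstable means not semistable, i.e. all non-constant homogeneous invariant polynomials on $V$ vanish at the equation. "Degenerates to a family" means that the orbit closure contains a nonzero form which, up to a change of coordinates, belongs to the family (in the paper the form is obtained as a limit under a one-parameter subgroup). "Of type / belongs to" a family means that the equation has the given shape after a change of coordinates. $q_d$ is an arbitrary form of degree $d$ in the indicated variables; different occurrences are independent, and each displayed monomial is understood with an arbitrary coefficient. SS1-VIII: $x_0x_1(x_2q_2(x_3,x_4)+q_3(x_3,x_4))$. SS2-VIII: $x_0x_1(q_2(x_2,x_3)x_4+q_1(x_2,x_3)x_4^2+x_4^3)$. US1-VIII: $x_0x_1(q_3(x_3,x_4)+x_2x_4^2)$. MO2-IV: $x_0x_1x_4q_2(x_2,x_3)$.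
   Formalization: Parts (2) and (3) exclude, up to coordinates, the forms c·x0x1x2x3x4 (whose orbit is closed) and c·x0x1x4^3 (which does not degenerate to MO2-IV), for which they fail; the "otherwise" part then also covers the former. *)

theory Defs
  imports "HOL-Analysis.Analysis"
begin

text \<open>
  Forms are rendered as polynomial functions on \<open>\<complex>\<^sup>5\<close>; since \<open>\<complex>\<close> is infinite, a form is determined
  by its function. The coordinates are \<open>x $ 0, \<dots>, x $ 4\<close>, the index type \<^typ>\<open>5\<close> having exactly
  the elements \<open>0, \<dots>, 4\<close>.
\<close>

type_synonym cpoint = "complex ^ 5"
type_synonym cform = "cpoint \<Rightarrow> complex"

definition exponents :: "5 set \<Rightarrow> nat \<Rightarrow> (5 \<Rightarrow> nat) set" where
  "exponents S d = {a. (\<forall>i. i \<notin> S \<longrightarrow> a i = 0) \<and> (\<Sum>i\<in>UNIV. a i) = d}"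

lemma finite_exponents: "finite (exponents S d)"
proof (rule finite_subset)
  show "exponents S d \<subseteq> PiE UNIV (\<lambda>_. {..d})"
    by (auto simp: exponents_def intro: member_le_sum)
  show "finite (PiE UNIV (\<lambda>_. {..d}) :: (5 \<Rightarrow> nat) set)"
    by (intro finite_PiE) auto
qed

text \<open>\<open>forms S d\<close> consists of all forms of degree \<open>d\<close> in the variables \<open>x\<^sub>i\<close>, \<open>i \<in> S\<close>, including \<open>0\<close>.\<close>

definition forms :: "5 set \<Rightarrow> nat \<Rightarrow> cform set" where
  "forms S d = {f. \<exists>c. f = (\<lambda>x. \<Sum>a\<in>exponents S d. c a * (\<Prod>i\<in>UNIV. x $ i ^ a i))}"

abbreviation quintics :: "cform set" where
  "quintics \<equiv> forms UNIV 5"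

text \<open>
  Substitution is a right action of the matrices; the left action \<open>f \<circ> g\<^sup>-\<^sup>1\<close> has the same orbits and
  the same invariants.
\<close>

definition change_coords :: "complex ^ 5 ^ 5 \<Rightarrow> cform \<Rightarrow> cform" where
  "change_coords g f = (\<lambda>x. f (g *v x))"

definition SL5_orbit :: "cform \<Rightarrow> cform set" where
  "SL5_orbit f = {change_coords g f | g. det g = 1}"

definition of_type :: "cform set \<Rightarrow> cform \<Rightarrow> bool" where
  "of_type F f \<longleftrightarrow> (\<exists>g. invertible g \<and> change_coords g f \<in> F)"

text \<open>
  \<^typ>\<open>cform\<close> carries the topology of pointwise convergence. On the finite-dimensional space
  \<^const>\<open>quintics\<close> it induces the usual Euclidean topology, because there is only one Hausdorff vector
  space topology on it; orbits of an algebraic group have the same closure there as in the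
  Zariski topology.
\<close>

definition closed_orbit :: "cform \<Rightarrow> bool" where
  "closed_orbit f \<longleftrightarrow> closedin (top_of_set quintics) (SL5_orbit f)"

definition degenerates_to :: "cform set \<Rightarrow> cform \<Rightarrow> bool" where
  "degenerates_to F f \<longleftrightarrow> (\<exists>h \<in> quintics \<inter> closure (SL5_orbit f). h \<noteq> (\<lambda>_. 0) \<and> of_type F h)"

definition linear_functional :: "(cform \<Rightarrow> complex) \<Rightarrow> bool" where
  "linear_functional L \<longleftrightarrow>
     (\<forall>f\<in>quintics. \<forall>h\<in>quintics. L (\<lambda>x. f x + h x) = L f + L h) \<and>
     (\<forall>c. \<forall>f\<in>quintics. L (\<lambda>x. c * f x) = c * L f)"

text \<open>
  Homogeneous polynomials of degree \<open>d\<close> on the space of quintic forms: the linear combinations of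
  products of \<open>d\<close> linear functionals.
\<close>

definition homogeneous_polynomial :: "nat \<Rightarrow> (cform \<Rightarrow> complex) \<Rightarrow> bool" where
  "homogeneous_polynomial d P \<longleftrightarrow>
     (\<exists>(n::nat) c L. (\<forall>k<n. \<forall>j<d. linear_functional (L k j)) \<and>
        (\<forall>f\<in>quintics. P f = (\<Sum>k<n. c k * (\<Prod>j<d. L k j f))))"

definition SL5_invariant :: "(cform \<Rightarrow> complex) \<Rightarrow> bool" where
  "SL5_invariant P \<longleftrightarrow> (\<forall>g. det g = 1 \<longrightarrow> (\<forall>f\<in>quintics. P (change_coords g f) = P f))"

definition semistable :: "cform \<Rightarrow> bool" where
  "semistable f \<longleftrightarrow>
     (\<exists>d>0. \<exists>P. homogeneous_polynomial d P \<and> SL5_invariant P \<and> P f \<noteq> 0)"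

definition unstable :: "cform \<Rightarrow> bool" where
  "unstable f \<longleftrightarrow> \<not> semistable f"

definition two_hyperplanes_and_cubic :: "cform set" where
  "two_hyperplanes_and_cubic = {\<lambda>x. x$0 * x$1 * q3 x | q3. q3 \<in> forms {2,3,4} 3}"

definition SS1_VIII :: "cform set" where
  "SS1_VIII = {\<lambda>x. x$0 * x$1 * (x$2 * q2 x + q3 x) | q2 q3.
     q2 \<in> forms {3,4} 2 \<and> q3 \<in> forms {3,4} 3}"

definition SS2_VIII :: "cform set" where
  "SS2_VIII = {\<lambda>x. x$0 * x$1 * (q2 x * x$4 + q1 x * (x$4)^2 + c * (x$4)^3) | q2 q1 c.
     q2 \<in> forms {2,3} 2 \<and> q1 \<in> forms {2,3} 1}"

definition US1_VIII :: "cform set" where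
  "US1_VIII = {\<lambda>x. x$0 * x$1 * (q3 x + c * x$2 * (x$4)^2) | q3 c. q3 \<in> forms {3,4} 3}"

definition MO2_IV :: "cform set" where
  "MO2_IV = {\<lambda>x. x$0 * x$1 * x$4 * q2 x | q2. q2 \<in> forms {2,3} 2}"

text \<open>
  All coefficients above may vanish, so \<^const>\<open>SS1_VIII\<close> and \<^const>\<open>SS2_VIII\<close> also contain two
  kinds of special members that do not behave like the others: five independent hyperplanes
  (the semistable members of \<^const>\<open>MO2_IV\<close>), whose orbit is closed, and \<open>x\<^sub>0x\<^sub>1x\<^sub>4\<^sup>3\<close> (an unstable
  member of \<^const>\<open>US1_VIII\<close>), which has no nonzero degeneration in \<^const>\<open>MO2_IV\<close> because every
  nonzero limit again has a triple linear factor.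
\<close>

definition five_hyperplanes :: "cform set" where
  "five_hyperplanes = {\<lambda>x. c * (x$0 * x$1 * x$2 * x$3 * x$4) | c. True}"

definition triple_hyperplane :: "cform set" where
  "triple_hyperplane = {\<lambda>x. c * (x$0 * x$1 * (x$4)^3) | c. True}"

definition exceptional :: "cform \<Rightarrow> bool" where
  "exceptional f \<longleftrightarrow> of_type five_hyperplanes f \<or> of_type triple_hyperplane f"

end

theory Submission
  imports Defs "HOL-Computational_Algebra.Fundamental_Theorem_Algebra"
begin

text \<open>
  Rescaling \<open>x\<^sub>0, x\<^sub>1\<close> shows that the orbit of \<open>x\<^sub>0x\<^sub>1q\<close> is governed by the orbit of the plane cubic
  \<open>q\<close> under \<open>SL(3)\<close>. Singular cubics are degenerated by explicit one-parameter subgroups, and a limit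
  in the orbit is excluded because members of \<open>MO2-IV\<close> are five independent hyperplanes or have 0 in
  their orbit closure. For a smooth cubic the orbit is closed by compactness: after the rows of \<open>g\<^sub>n\<close>
  belonging to \<open>x\<^sub>0, x\<^sub>1\<close> have been normalized, convergence of the quintics forces the values of
  \<open>q \<circ> g\<^sub>n\<close> to converge, and smoothness then bounds \<open>g\<^sub>n\<close>.
\<close>

subsection \<open>Forms\<close>

text \<open>Points of an orbit closure are, a priori, only limits of nets in a function space that
  is not first countable, while compactness arguments need sequences; finitely many evaluation
  points determine a quintic and bridge this gap. A second obstacle is that the stabiliser of
  \<open>x0 * x1 * q\<close> contains a noncompact torus, so matrices may diverge although the
  quintics converge: boundedness can be asked only after correction by stabiliser elements. The case
  division rests on one observation: if the cubic has a singular point, moving it to (1, 0, 0)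
  removes the terms of degree 3 and 2 in \<open>x2\<close>, and what is left has the shape SS1-VIII.
  Hence outside SS1-VIII only smooth cubics remain, and the closed orbits left inside it are those
  of five independent hyperplanes. All one-parameter subgroups fix \<open>x0\<close> and
  \<open>x1\<close> and have weights of sum 0 on the other three variables. For a degeneration the
  part to be kept gets weight 0 and the rest positive weight; for US1-VIII every monomial gets
  positive weight.\<close>

lemma exhaust_5: fixes i :: 5 shows "i = 0 \<or> i = 1 \<or> i = 2 \<or> i = 3 \<or> i = 4"
proof (induct i)
  case (of_int z)
  then have "z = 0 \<or> z = 1 \<or> z = 2 \<or> z = 3 \<or> z = 4" by fastforce
  then show ?case by auto
qed

lemma UNIV_5: "UNIV = {0, 1, 2, 3, 4 :: 5}"
  using exhaust_5 by auto

lemma forall_5: "(\<forall>i::5. P i) \<longleftrightarrow> P 0 \<and> P 1 \<and> P 2 \<and> P 3 \<and> P 4"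
  by (metis exhaust_5)

lemma sum_5: "sum f (UNIV :: 5 set) = f 0 + f 1 + f 2 + f 3 + f 4"
  unfolding UNIV_5 by (simp add: ac_simps)

lemma prod_5: "prod f (UNIV :: 5 set) = f 0 * f 1 * f 2 * f 3 * f 4"
  unfolding UNIV_5 by (simp add: ac_simps)

definition monom_fun :: "(5 \<Rightarrow> nat) \<Rightarrow> cform" where
  "monom_fun a = (\<lambda>x. \<Prod>i\<in>UNIV. x $ i ^ a i)"

lemma forms_iff: "f \<in> forms S d \<longleftrightarrow> (\<exists>c. f = (\<lambda>x. \<Sum>a\<in>exponents S d. c a * monom_fun a x))"
  by (simp add: forms_def monom_fun_def)

lemma forms_zero: "(\<lambda>_. 0) \<in> forms S d"
  unfolding forms_iff by (intro exI[of _ "\<lambda>_. 0"]) simp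

lemma forms_add:
  assumes "f \<in> forms S d" "h \<in> forms S d" shows "(\<lambda>x. f x + h x) \<in> forms S d"
proof -
  obtain c c' where "f = (\<lambda>x. \<Sum>a\<in>exponents S d. c a * monom_fun a x)"
    "h = (\<lambda>x. \<Sum>a\<in>exponents S d. c' a * monom_fun a x)"
    using assms unfolding forms_iff by blast
  then show ?thesis
    unfolding forms_iff
    by (intro exI[of _ "\<lambda>a. c a + c' a"]) (simp add: sum.distrib algebra_simps)
qed

lemma forms_scale:
  assumes "f \<in> forms S d" shows "(\<lambda>x. k * f x) \<in> forms S d"
proof -
  obtain c where "f = (\<lambda>x. \<Sum>a\<in>exponents S d. c a * monom_fun a x)"
    using assms unfolding forms_iff by blast
  then show ?thesis
    unfolding forms_iff
    by (intro exI[of _ "\<lambda>a. k * c a"]) (simp add: sum_distrib_left algebra_simps)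
qed

lemma forms_sum:
  assumes "\<And>k. k \<in> K \<Longrightarrow> f k \<in> forms S d" shows "(\<lambda>x. \<Sum>k\<in>K. f k x) \<in> forms S d"
  using assms by (induction K rule: infinite_finite_induct) (auto intro: forms_zero forms_add)

lemma forms_monom:
  assumes "a \<in> exponents S d" shows "monom_fun a \<in> forms S d"
proof -
  have "(\<Sum>b\<in>exponents S d. (if b = a then 1 else 0) * monom_fun b x) =
      (\<Sum>b\<in>exponents S d. if b = a then monom_fun b x else 0)" for x
    by (intro sum.cong) auto
  then have "(\<Sum>b\<in>exponents S d. (if b = a then 1 else 0) * monom_fun b x) = monom_fun a x" for x
    using assms by (simp add: finite_exponents)
  then show ?thesis
    unfolding forms_iff by (intro exI[of _ "\<lambda>b. if b = a then 1 else 0"]) simp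
qed

text \<open>Forms are sums of scaled monomials, so any property stable under addition has to be
  checked on these only. Most closure and evaluation facts about \<open>forms\<close> follow this
  pattern.\<close>

lemma forms_induct [consumes 1, case_names zero add monom]:
  assumes f: "f \<in> forms S d"
    and zero: "P (\<lambda>_. 0)"
    and add: "\<And>f h. P f \<Longrightarrow> P h \<Longrightarrow> P (\<lambda>x. f x + h x)"
    and monom: "\<And>a c. a \<in> exponents S d \<Longrightarrow> P (\<lambda>x. c * monom_fun a x)"
  shows "P f"
proof -
  obtain c where c: "f = (\<lambda>x. \<Sum>a\<in>exponents S d. c a * monom_fun a x)"
    using f unfolding forms_iff by blast
  have "P (\<lambda>x. \<Sum>a\<in>A. c a * monom_fun a x)" if "A \<subseteq> exponents S d" for A
    using that
  proof (induction A rule: infinite_finite_induct)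
    case (insert a A)
    then show ?case using add[of "\<lambda>x. c a * monom_fun a x"] monom by simp
  qed (simp_all add: zero)
  then show ?thesis using c by simp
qed

lemma forms_mult:
  assumes "f \<in> forms S d" "h \<in> forms S e" shows "(\<lambda>x. f x * h x) \<in> forms S (d + e)"
  using assms(1)
proof (induction rule: forms_induct)
  case (monom a c)
  show ?case using assms(2)
  proof (induction rule: forms_induct)
    case (monom b c')
    have "(\<lambda>x. (c * monom_fun a x) * (c' * monom_fun b x)) =
        (\<lambda>x. c * c' * monom_fun (\<lambda>i. a i + b i) x)"
      by (simp add: monom_fun_def power_add prod.distrib algebra_simps)
    moreover have "(\<lambda>i. a i + b i) \<in> exponents S (d + e)"
      using monom \<open>a \<in> _\<close> by (simp add: exponents_def sum.distrib)
    ultimately show ?case by (metis (no_types) forms_monom forms_scale)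
  qed (simp_all add: forms_zero forms_add algebra_simps)
qed (simp_all add: forms_zero forms_add algebra_simps)

lemma forms_const: "(\<lambda>_. c) \<in> forms S 0"
proof -
  have "(\<lambda>_. 0) \<in> exponents S 0" by (simp add: exponents_def)
  from forms_scale[OF forms_monom[OF this], of c] show ?thesis
    by (simp add: monom_fun_def)
qed

lemma forms_coord:
  assumes "i \<in> S" shows "(\<lambda>x. x $ i) \<in> forms S (Suc 0)"
proof -
  have "(\<lambda>j. if j = i then 1 else 0) \<in> exponents S 1"
    using assms by (simp add: exponents_def)
  moreover have "monom_fun (\<lambda>j. if j = i then 1 else 0) = (\<lambda>x. x $ i)"
    by (simp add: monom_fun_def if_distrib prod.delta cong: if_cong)
  ultimately show ?thesis using forms_monom by fastforce
qed

lemma forms_mult':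
  assumes "f \<in> forms S d" "h \<in> forms S e" "n = d + e" shows "(\<lambda>x. f x * h x) \<in> forms S n"
  using forms_mult assms by simp

lemma forms_power: "f \<in> forms S d \<Longrightarrow> (\<lambda>x. f x ^ n) \<in> forms S (n * d)"
  by (induction n) (auto intro: forms_const forms_mult)

lemma forms_power':
  assumes "f \<in> forms S (Suc 0)" shows "(\<lambda>x. f x ^ n) \<in> forms S n"
  using forms_power[OF assms, of n] by simp

lemma forms_mono:
  assumes "f \<in> forms S d" "S \<subseteq> T" shows "f \<in> forms T d"
  using assms(1)
proof (induction rule: forms_induct)
  case (monom a c)
  have "a \<in> exponents T d" using monom assms(2) by (auto simp: exponents_def)
  then show ?case by (intro forms_scale forms_monom)
qed (auto intro: forms_zero forms_add)

lemma forms_prod: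
  assumes "finite I" "\<And>i. i \<in> I \<Longrightarrow> f i \<in> forms S (d i)"
  shows "(\<lambda>x. \<Prod>i\<in>I. f i x) \<in> forms S (\<Sum>i\<in>I. d i)"
  using assms by (induction I rule: finite_induct) (auto intro: forms_const forms_mult)

text \<open>Linearity of \<open>L\<close> is asked only for coordinates in \<open>S\<close>:
  elsewhere the exponents are 0 and the factor is the constant 1.\<close>

lemma forms_subst:
  assumes "f \<in> forms S d" and L: "\<And>i. i \<in> S \<Longrightarrow> (\<lambda>x. L x $ i) \<in> forms T (Suc 0)"
  shows "(\<lambda>x. f (L x)) \<in> forms T d"
  using assms(1)
proof (induction rule: forms_induct)
  case (monom a c)
  have "(\<lambda>x. L x $ i ^ a i) \<in> forms T (a i)" for i
  proof (cases "i \<in> S")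
    case True
    then show ?thesis using L forms_power' by blast
  next
    case False
    then have "a i = 0" using monom by (simp add: exponents_def)
    then show ?thesis using forms_const by simp
  qed
  then have "(\<lambda>x. \<Prod>i\<in>UNIV. L x $ i ^ a i) \<in> forms T (\<Sum>i\<in>UNIV. a i)"
    by (intro forms_prod) auto
  moreover have "(\<Sum>i\<in>UNIV. a i) = d" using monom by (simp add: exponents_def)
  ultimately show ?case by (simp add: monom_fun_def forms_scale)
qed (auto intro: forms_zero forms_add)

lemma forms_matrix_row: "(\<lambda>x. (g *v x) $ i) \<in> forms UNIV (Suc 0)"
  unfolding matrix_vector_mult_def by (simp add: forms_sum forms_scale forms_coord)

lemma forms_change_coords: "f \<in> forms UNIV d \<Longrightarrow> (\<lambda>x. f (g *v x)) \<in> forms UNIV d"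
  by (rule forms_subst) (auto intro: forms_matrix_row)

text \<open>Thanks to this, a diagonal matrix with equal entries on \<open>S\<close> acts on a form
  in the variables \<open>S\<close> like a scalar, so that homogeneity applies.\<close>

lemma forms_cong_coords:
  assumes "f \<in> forms S d" "\<And>i. i \<in> S \<Longrightarrow> x $ i = y $ i" shows "f x = f y"
  using assms(1)
proof (induction rule: forms_induct)
  case (monom a c)
  have "x $ i ^ a i = y $ i ^ a i" for i
    using monom assms(2)[of i] by (cases "i \<in> S") (auto simp: exponents_def)
  then show ?case by (simp add: monom_fun_def)
qed auto

lemma forms_homogeneous:
  assumes "f \<in> forms S d" shows "f (c *s x) = c ^ d * f x"
  using assms
proof (induction rule: forms_induct)
  case (monom a k)
  then have "(\<Sum>i\<in>UNIV. a i) = d" by (simp add: exponents_def)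
  then show ?case
    by (simp add: monom_fun_def power_mult_distrib prod.distrib power_sum[symmetric])
qed (auto simp: algebra_simps)

lemma forms_continuous:
  assumes "f \<in> forms S d" shows "continuous_on UNIV f"
  using assms
  by (induction rule: forms_induct) (auto intro!: continuous_intros simp: monom_fun_def)

lemma forms_tendsto:
  assumes "f \<in> forms S d" "(g \<longlongrightarrow> x) F" shows "((\<lambda>n. f (g n)) \<longlongrightarrow> f x) F"
  using forms_continuous[OF assms(1)] assms(2)
  by (metis UNIV_I continuous_on_eq_continuous_at isCont_tendsto_compose open_UNIV)

lemma forms_0E:
  assumes "f \<in> forms S 0" obtains c where "f = (\<lambda>_. c)"
proof -
  have "\<exists>c. f = (\<lambda>_. c)" using assms
  proof (induction rule: forms_induct)
    case (monom a c)
    then have "a = (\<lambda>_. 0)" by (auto simp: exponents_def)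
    then show ?case by (auto simp: monom_fun_def)
  qed auto
  then show ?thesis using that by blast
qed

text \<open>Division by \<open>x $ i\<close>: monomials containing this variable contribute to
  \<open>u\<close>, the others to \<open>v\<close>. Iterating it yields explicit
  coefficients.\<close>

lemma forms_insertE:
  assumes "f \<in> forms (insert i S) (Suc d)"
  obtains u v where "u \<in> forms (insert i S) d" "v \<in> forms S (Suc d)" "f = (\<lambda>x. x $ i * u x + v x)"
proof -
  have "\<exists>u v. u \<in> forms (insert i S) d \<and> v \<in> forms S (Suc d) \<and> f = (\<lambda>x. x $ i * u x + v x)"
    using assms
  proof (induction rule: forms_induct)
    case zero
    show ?case
      by (intro exI[of _ "\<lambda>_. 0"]) (simp add: forms_zero)
  next
    case (add f h)
    then obtain u v u' v' where "u \<in> forms (insert i S) d" "v \<in> forms S (Suc d)"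
      "u' \<in> forms (insert i S) d" "v' \<in> forms S (Suc d)"
      "f = (\<lambda>x. x $ i * u x + v x)" "h = (\<lambda>x. x $ i * u' x + v' x)" by blast
    then show ?case
      by (intro exI[of _ "\<lambda>x. u x + u' x"] exI[of _ "\<lambda>x. v x + v' x"])
        (simp add: forms_add algebra_simps)
  next
    case (monom a c)
    show ?case
    proof (cases "a i")
      case 0
      then have "a j = 0" if "j \<notin> S" for j
        using monom that by (cases "j = i") (auto simp: exponents_def)
      then have "a \<in> exponents S (Suc d)" using monom by (simp add: exponents_def)
      then show ?thesis
        by (intro exI[of _ "\<lambda>_. 0"] exI[of _ "\<lambda>x. c * monom_fun a x"])
          (simp add: forms_zero forms_scale forms_monom)
    next
      case (Suc k)
      define b where "b = a(i := k)"
      have "(\<Sum>j\<in>UNIV. a j) = Suc (\<Sum>j\<in>UNIV. b j)"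
        using Suc by (simp add: b_def sum.remove[of UNIV i])
      then have b: "b \<in> exponents (insert i S) d"
        using monom by (auto simp: exponents_def b_def)
      have "monom_fun a x = x $ i * monom_fun b x" for x
        using Suc by (simp add: b_def monom_fun_def prod.remove[of UNIV i])
      then show ?thesis
        using b by (intro exI[of _ "\<lambda>x. c * monom_fun b x"] exI[of _ "\<lambda>_. 0"] conjI)
          (simp_all add: forms_zero forms_scale forms_monom mult.left_commute)
    qed
  qed
  then show ?thesis using that by blast
qed

lemma forms_emptyE:
  assumes "f \<in> forms {} (Suc d)" shows "f = (\<lambda>_. 0)"
  using assms by (induction rule: forms_induct) (auto simp: exponents_def)

section \<open>Explicit coefficients of linear, binary and unary forms\<close>

lemma forms_1_insertE:
  assumes "f \<in> forms (insert i S) (Suc 0)"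
  obtains c v where "v \<in> forms S (Suc 0)" "f = (\<lambda>x. c * x $ i + v x)"
proof -
  obtain u v where uv: "u \<in> forms (insert i S) 0" "v \<in> forms S (Suc 0)"
    "f = (\<lambda>x. x $ i * u x + v x)" using assms by (rule forms_insertE)
  from uv(1) obtain c where "u = (\<lambda>_. c)" by (rule forms_0E)
  with uv that[of v c] show ?thesis by (simp add: mult.commute)
qed

lemma binary_linear:
  assumes "f \<in> forms {i, j} (Suc 0)"
  obtains a b where "f = (\<lambda>x. a * x $ i + b * x $ j)"
proof -
  obtain a v where v: "v \<in> forms {j} (Suc 0)" "f = (\<lambda>x. a * x $ i + v x)"
    using assms by (rule forms_1_insertE)
  obtain b w where "w \<in> forms {} (Suc 0)" "v = (\<lambda>x. b * x $ j + w x)"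
    using v(1) by (rule forms_1_insertE)
  then have "f = (\<lambda>x. a * x $ i + b * x $ j)" using v(2) forms_emptyE[of w 0] by simp
  then show ?thesis by (rule that)
qed

lemma unary_form:
  assumes "f \<in> forms {i} d" obtains a where "f = (\<lambda>x. a * x $ i ^ d)"
proof -
  have "\<exists>a. f = (\<lambda>x. a * x $ i ^ d)"
    using assms
  proof (induction d arbitrary: f)
    case 0
    then obtain c where "f = (\<lambda>_. c)" by (rule forms_0E)
    then show ?case by (intro exI[of _ c]) simp
  next
    case (Suc d)
    obtain u v where uv: "u \<in> forms {i} d" "v \<in> forms {} (Suc d)" "f = (\<lambda>x. x $ i * u x + v x)"
      using Suc.prems by (rule forms_insertE)
    obtain a where "u = (\<lambda>x. a * x $ i ^ d)" using Suc.IH[OF uv(1)] by blast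
    with uv(3) forms_emptyE[OF uv(2)] show ?case by (intro exI[of _ a]) (simp add: mult.left_commute)
  qed
  then show ?thesis using that by blast
qed

lemma binary_quadratic:
  assumes "f \<in> forms {i, j} 2"
  obtains a b c where "f = (\<lambda>x. a * (x $ i)^2 + b * x $ i * x $ j + c * (x $ j)^2)"
proof -
  have "f \<in> forms {i, j} (Suc (Suc 0))" using assms by (simp add: numeral_2_eq_2)
  then obtain u v where uv: "u \<in> forms {i, j} (Suc 0)" "v \<in> forms {j} (Suc (Suc 0))"
    "f = (\<lambda>x. x $ i * u x + v x)" by (rule forms_insertE)
  obtain a b where "u = (\<lambda>x. a * x $ i + b * x $ j)" using uv(1) by (rule binary_linear)
  moreover obtain c where "v = (\<lambda>x. c * x $ j ^ Suc (Suc 0))" using uv(2) by (rule unary_form)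
  ultimately show ?thesis using uv that by (simp add: algebra_simps power2_eq_square)
qed

lemma binary_cubic:
  assumes "f \<in> forms {i, j} 3"
  obtains a b c d where
    "f = (\<lambda>x. a * (x $ i)^3 + b * (x $ i)^2 * x $ j + c * x $ i * (x $ j)^2 + d * (x $ j)^3)"
proof -
  have "f \<in> forms {i, j} (Suc 2)" using assms by (simp add: numeral_3_eq_3 numeral_2_eq_2)
  then obtain u v where uv: "u \<in> forms {i, j} 2" "v \<in> forms {j} (Suc 2)"
    "f = (\<lambda>x. x $ i * u x + v x)" by (rule forms_insertE)
  obtain a b c where "u = (\<lambda>x. a * (x $ i)^2 + b * x $ i * x $ j + c * (x $ j)^2)"
    using uv(1) by (rule binary_quadratic)
  moreover obtain d where "v = (\<lambda>x. d * x $ j ^ Suc 2)" using uv(2) by (rule unary_form)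
  ultimately show ?thesis using uv that[of a b c d]
    by (simp add: algebra_simps power2_eq_square power3_eq_cube)
qed

subsection \<open>Orbits and limits\<close>

lemma change_coords_mult: "change_coords g (change_coords k f) = change_coords (k ** g) f"
  by (simp add: change_coords_def matrix_vector_mul_assoc)

lemma SL5_orbit_change_coords:
  assumes "det s = 1" shows "SL5_orbit (change_coords s f) = SL5_orbit f"
proof
  show "SL5_orbit (change_coords s f) \<subseteq> SL5_orbit f"
    using assms by (auto simp: SL5_orbit_def change_coords_mult) (metis det_mul mult_1)
  obtain t where t: "s ** t = mat 1" "t ** s = mat 1"
    using assms by (metis invertible_det_nz invertible_def zero_neq_one)
  then have "det t = 1" using assms det_mul[of s t] by simp
  moreover have "change_coords g f = change_coords (t ** g) (change_coords s f)" for g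
  proof -
    have "s ** (t ** g) = g" by (metis matrix_mul_assoc matrix_mul_lid t(1))
    then show ?thesis by (simp only: change_coords_mult)
  qed
  ultimately show "SL5_orbit f \<subseteq> SL5_orbit (change_coords s f)"
    unfolding SL5_orbit_def by (smt (verit) Collect_mono det_mul mult_1)
qed

lemma of_type_change_coords:
  assumes "invertible g" "of_type F (change_coords g f)" shows "of_type F f"
  using assms unfolding of_type_def change_coords_mult by (metis invertible_mult)

text \<open>Membership in \<open>forms\<close> of degree 1 gives five explicit coefficients, one per
  peeled-off variable, which makes \<open>L\<close> linear and hence a matrix.\<close>

lemma matrix_of_linear_forms:
  assumes "\<And>i. (\<lambda>x. L x $ i) \<in> forms UNIV (Suc 0)"
  obtains g where "\<And>x. g *v x = L x"
proof -
  have lin: "L (x + y) $ i = L x $ i + L y $ i \<and> L (c *s x) $ i = c * L x $ i" for x y c i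
  proof -
    have "(\<lambda>x. L x $ i) \<in> forms (insert 0 (insert 1 (insert 2 (insert 3 {4})))) (Suc 0)"
      using assms[of i] by (simp add: UNIV_5)
    then obtain a0 v0 where 0: "v0 \<in> forms (insert 1 (insert 2 (insert 3 {4}))) (Suc 0)"
      "(\<lambda>x. L x $ i) = (\<lambda>x. a0 * x $ 0 + v0 x)" by (rule forms_1_insertE)
    from 0(1) obtain a1 v1 where 1: "v1 \<in> forms (insert 2 (insert 3 {4})) (Suc 0)"
      "v0 = (\<lambda>x. a1 * x $ 1 + v1 x)" by (rule forms_1_insertE)
    from 1(1) obtain a2 v2 where 2: "v2 \<in> forms {3, 4} (Suc 0)"
      "v1 = (\<lambda>x. a2 * x $ 2 + v2 x)" by (rule forms_1_insertE)
    from 2(1) obtain a3 a4 where 3: "v2 = (\<lambda>x. a3 * x $ 3 + a4 * x $ 4)" by (rule binary_linear)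
    have "L x $ i = a0 * x $ 0 + (a1 * x $ 1 + (a2 * x $ 2 + (a3 * x $ 3 + a4 * x $ 4)))" for x
      using 0(2)[THEN fun_cong, of x] 1(2) 2(2) 3 by simp
    then show ?thesis by (simp add: algebra_simps)
  qed
  have "Vector_Spaces.linear (*s) (*s) L"
    using lin by unfold_locales (auto simp: vec_eq_iff)
  then show ?thesis using matrix_works by (intro that[of "matrix L"]) blast
qed

text \<open>Coordinate changes can thus be written as vectors of linear forms; a trivial kernel
  makes the square matrix invertible.\<close>

lemma of_typeI:
  assumes "\<And>i. (\<lambda>x. L x $ i) \<in> forms UNIV (Suc 0)" "\<And>x. L x = 0 \<Longrightarrow> x = 0" "(\<lambda>x. f (L x)) \<in> F"
  shows "of_type F f"
proof -
  obtain g where g: "\<And>x. g *v x = L x"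
    using matrix_of_linear_forms[OF assms(1)] by blast
  have "invertible g"
    using assms(2) by (auto simp: invertible_left_inverse matrix_left_invertible_ker g)
  then show ?thesis using assms(3) by (auto simp: of_type_def change_coords_def g)
qed

lemma of_type_self: "f \<in> F \<Longrightarrow> of_type F f"
  by (rule of_typeI[where L = "\<lambda>x. x"]) (auto intro: forms_coord)

text \<open>An invertible matrix is a scalar times one of determinant 1, and scalars act on quintics by
  scalars.\<close>

lemma of_type_SL5E:
  assumes "of_type F f" "f \<in> quintics" "\<And>c h. h \<in> F \<Longrightarrow> (\<lambda>x. c * h x) \<in> F"
  obtains s where "det s = 1" "change_coords s f \<in> F"
proof -
  obtain g where g: "invertible g" "change_coords g f \<in> F"
    using assms(1) by (auto simp: of_type_def)
  then have d: "det g \<noteq> 0" using invertible_det_nz by blast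
  \<comment> \<open>A fifth root of the determinant, since scaling all five rows by
    \<open>1 / k\<close> divides it by \<open>k ^ 5\<close>.\<close>
  define k where "k = exp (Ln (det g) / 5)"
  have k: "k ^ 5 = det g"
    using d exp_of_nat_mult[of 5 "Ln (det g) / 5"] by (simp add: k_def)
  define s where "s = (\<chi> i. (1 / k) *s g $ i)"
  have sx: "s *v x = (1 / k) *s (g *v x)" for x
    by (simp add: s_def vec_eq_iff matrix_vector_mult_def sum_distrib_left mult.assoc)
  have "det s = (1 / k) ^ 5 * det g"
    unfolding s_def by (subst det_rows_mul) simp
  then have "det s = 1" using k d by (simp add: power_divide)
  moreover have "change_coords s f = (\<lambda>x. (1 / k) ^ 5 * change_coords g f x)"
    using forms_homogeneous[OF assms(2)] by (simp add: change_coords_def sx)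
  ultimately show ?thesis using that[of s] assms(3)[OF g(2)] by simp
qed

lemma closed_orbit_change_coords:
  "det s = 1 \<Longrightarrow> closed_orbit (change_coords s f) \<longleftrightarrow> closed_orbit f"
  by (simp add: closed_orbit_def SL5_orbit_change_coords)

lemma SL5_orbit_quintics: "f \<in> quintics \<Longrightarrow> SL5_orbit f \<subseteq> quintics"
  by (auto simp: SL5_orbit_def change_coords_def forms_change_coords)

lemma tendsto_fun_pointwise:
  fixes f :: "'c \<Rightarrow> 'a \<Rightarrow> 'b::topological_space"
  assumes "\<And>x. ((\<lambda>n. f n x) \<longlongrightarrow> h x) F" shows "(f \<longlongrightarrow> h) F"
  using assms limitin_componentwise[of "\<lambda>_. euclidean" UNIV f h F]
  by (simp add: euclidean_product_topology)

lemma orbit_limit_in_closure: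
  assumes "\<And>n. det (g n) = 1" "\<And>x. (\<lambda>n. f (g n *v x)) \<longlonglongrightarrow> h x"
  shows "h \<in> closure (SL5_orbit f)"
proof (rule Lim_in_closed_set[of _ "\<lambda>n::nat. change_coords (g n) f" sequentially])
  show "(\<lambda>n. change_coords (g n) f) \<longlonglongrightarrow> h"
    using assms(2) by (intro tendsto_fun_pointwise) (simp add: change_coords_def)
  show "\<forall>\<^sub>F n in sequentially. change_coords (g n) f \<in> closure (SL5_orbit f)"
    using assms(1) by (intro always_eventually allI subsetD[OF closure_subset]) (auto simp: SL5_orbit_def)
qed auto

lemma closed_orbit_closureD:
  assumes "closed_orbit f" "h \<in> quintics" "h \<in> closure (SL5_orbit f)" shows "h \<in> SL5_orbit f"
proof -
  obtain T where T: "closed T" "SL5_orbit f = quintics \<inter> T"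
    using assms(1) unfolding closed_orbit_def closedin_closed by auto
  then have "closure (SL5_orbit f) \<subseteq> T" by (simp add: closure_minimal)
  then show ?thesis using T assms by auto
qed

subsection \<open>Interpolation\<close>

text \<open>The weights are the values at \<open>x\<close> of the Lagrange basis polynomials for the
  nodes 0, ..., d. They serve all exponents \<open>n\<close> up to \<open>d\<close> at once, which
  makes products over several variables possible.\<close>

lemma lagrange_interpolation:
  fixes x :: complex
  obtains l :: "nat \<Rightarrow> complex" where "\<And>n. n \<le> d \<Longrightarrow> x ^ n = (\<Sum>k\<le>d. l k * of_nat k ^ n)"
proof -
  define L :: "nat \<Rightarrow> complex poly" where
    "L k = (\<Prod>j\<in>{..d} - {k}. smult (1 / (of_nat k - of_nat j)) [:- of_nat j, 1:])" for k
  have deg: "degree (L k) \<le> d" if "k \<le> d" for k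
  proof -
    have "degree (L k) \<le> (\<Sum>j\<in>{..d} - {k}. degree (smult (1 / (of_nat k - of_nat j)) [:- of_nat j, 1::complex:]))"
      unfolding L_def by (rule order_trans[OF degree_prod_sum_le]) auto
    also have "\<dots> \<le> (\<Sum>j\<in>{..d} - {k}. 1)" by (intro sum_mono) simp
    also have "\<dots> = d" using that by simp
    finally show ?thesis .
  qed
  have val: "poly (L k) (of_nat i) = (if i = k then 1 else 0)" if "k \<le> d" "i \<le> d" for i k
  proof (cases "i = k")
    case True
    have "poly (smult (1 / (of_nat k - of_nat j)) [:- of_nat j, 1:]) (of_nat k) = (1::complex)"
      if "j \<noteq> k" for j
    proof -
      have "of_nat k - of_nat j \<noteq> (0::complex)" using that by simp
      then show ?thesis unfolding poly_smult by simp
    qed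
    then show ?thesis using True unfolding L_def poly_prod by (auto intro!: prod.neutral)
  next
    case False
    then have "i \<in> {..d} - {k}" using that by simp
    then show ?thesis using False by (auto simp: L_def poly_prod intro!: prod_zero)
  qed
  have "x ^ n = (\<Sum>k\<le>d. poly (L k) x * of_nat k ^ n)" if n: "n \<le> d" for n
  proof -
    \<comment> \<open>Both sides have degree at most \<open>d\<close> and agree at the
      \<open>d + 1\<close> nodes.\<close>
    have "monom 1 n = (\<Sum>k\<le>d. smult (of_nat k ^ n) (L k))"
    proof (rule poly_eqI_degree[where A = "of_nat ` {..d}"])
      fix y :: complex assume "y \<in> of_nat ` {..d}"
      then obtain i where i: "i \<le> d" "y = of_nat i" by auto
      have "(\<Sum>k\<le>d. of_nat k ^ n * poly (L k) y) = (\<Sum>k\<le>d. if k = i then of_nat i ^ n else 0)"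
        using i val by (intro sum.cong) auto
      then show "poly (monom 1 n) y = poly (\<Sum>k\<le>d. smult (of_nat k ^ n) (L k)) y"
        using i by (simp add: poly_monom poly_sum)
    next
      have c: "card (of_nat ` {..d} :: complex set) = Suc d"
        by (subst card_image) (auto simp: inj_on_def)
      show "degree (monom 1 n :: complex poly) < card (of_nat ` {..d} :: complex set)"
        using n by (simp add: c degree_monom_eq)
      have "degree (\<Sum>k\<le>d. smult (of_nat k ^ n) (L k)) \<le> d"
        using deg by (intro degree_sum_le) (auto intro: order_trans[OF degree_smult_le])
      then show "degree (\<Sum>k\<le>d. smult (of_nat k ^ n) (L k)) < card (of_nat ` {..d} :: complex set)"
        by (simp add: c)
    qed
    from arg_cong[OF this, of "\<lambda>p. poly p x"] show ?thesis
      by (simp add: poly_monom poly_sum mult.commute)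
  qed
  then show ?thesis using that[of "\<lambda>k. poly (L k) x"] by blast
qed

text \<open>A form of degree \<open>d\<close> has degree at most \<open>d\<close> in each variable,
  so the product of five one-variable interpolations recovers it from the integer grid with
  coordinates 0, ..., d. The weights depend on \<open>x\<close> but not on the form.\<close>

lemma forms_interpolation:
  obtains Y :: "cpoint set" where "finite Y"
    "\<And>x. \<exists>w. \<forall>f\<in>forms UNIV d. f x = (\<Sum>y\<in>Y. w y * f y)"
proof -
  define K :: "(5 \<Rightarrow> nat) set" where "K = PiE UNIV (\<lambda>_. {..d})"
  define pt :: "(5 \<Rightarrow> nat) \<Rightarrow> cpoint" where "pt k = (\<chi> i. of_nat (k i))" for k
  have fin: "finite K" unfolding K_def by (intro finite_PiE) auto
  have inj: "inj_on pt K" by (auto simp: inj_on_def pt_def vec_eq_iff fun_eq_iff)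
  have "\<exists>w. \<forall>f\<in>forms UNIV d. f x = (\<Sum>y\<in>pt ` K. w y * f y)" for x
  proof -
    have "\<exists>l :: nat \<Rightarrow> complex. \<forall>n\<le>d. x $ i ^ n = (\<Sum>k\<le>d. l k * of_nat k ^ n)" for i
      by (metis lagrange_interpolation)
    then obtain l where l: "\<And>i n. n \<le> d \<Longrightarrow> x $ i ^ n = (\<Sum>k\<le>d. l i k * of_nat k ^ n)" by metis
    have *: "f x = (\<Sum>k\<in>K. (\<Prod>i\<in>UNIV. l i (k i)) * f (pt k))" if "f \<in> forms UNIV d" for f
      using that
    proof (induction rule: forms_induct)
      case (monom a c)
      have a: "a i \<le> d" for i
        using monom member_le_sum[of i UNIV a] by (simp add: exponents_def)
      have "monom_fun a x = (\<Prod>i\<in>UNIV. \<Sum>k\<le>d. l i k * of_nat k ^ a i)"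
        by (simp add: monom_fun_def l[OF a])
      also have "\<dots> = (\<Sum>k\<in>K. \<Prod>i\<in>UNIV. l i (k i) * of_nat (k i) ^ a i)"
        unfolding K_def by (rule prod_sum_PiE) auto
      also have "\<dots> = (\<Sum>k\<in>K. (\<Prod>i\<in>UNIV. l i (k i)) * monom_fun a (pt k))"
        by (simp add: prod.distrib monom_fun_def pt_def)
      finally show ?case by (simp add: sum_distrib_left algebra_simps)
    qed (auto simp: sum.distrib algebra_simps)
    show ?thesis
      by (rule exI[of _ "\<lambda>y. \<Prod>i\<in>UNIV. l i (inv_into K pt y i)"])
        (auto simp: * sum.reindex[OF inj] inv_into_f_f[OF inj] intro!: sum.cong)
  qed
  then show ?thesis using that[of "pt ` K"] fin by blast
qed

text \<open>Closeness on the finite interpolation set \<open>Y\<close> can be imposed by an open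
  set, and shrinking radii give a sequence. Convergence on \<open>Y\<close> then spreads to every
  point, because each value of a quintic is a fixed linear combination of its values on
  \<open>Y\<close>.\<close>

lemma closure_orbit_sequence:
  assumes f: "f \<in> quintics" and h: "h \<in> quintics" "h \<in> closure (SL5_orbit f)"
  obtains g where "\<And>n. det (g n) = 1" "\<And>x. (\<lambda>n::nat. f (g n *v x)) \<longlonglongrightarrow> h x"
proof -
  obtain Y :: "cpoint set" where Y: "finite Y"
    "\<And>x. \<exists>w. \<forall>f\<in>quintics. f x = (\<Sum>y\<in>Y. w y * f y)"
    using forms_interpolation[of 5] by blast
  have "\<exists>g. det g = 1 \<and> (\<forall>y\<in>Y. dist (f (g *v y)) (h y) < inverse (Suc n))" for n :: nat
  proof -
    define U where "U = (\<Inter>y\<in>Y. (\<lambda>u::cform. u y) -` ball (h y) (inverse (Suc n)))"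
    have "open U" unfolding U_def using Y(1)
      by (intro open_INT ballI open_vimage continuous_on_product_coordinates open_ball)
    moreover have "h \<in> U" by (simp add: U_def)
    ultimately have "SL5_orbit f \<inter> U \<noteq> {}"
      using h(2) closure_iff_nhds_not_empty by blast
    then show ?thesis
      by (auto simp: SL5_orbit_def U_def change_coords_def dist_commute)
  qed
  then obtain g where g: "\<And>n. det (g n) = 1"
    "\<And>n y. y \<in> Y \<Longrightarrow> dist (f (g n *v y)) (h y) < inverse (Suc n)" by metis
  have Ylim: "(\<lambda>n. f (g n *v y)) \<longlonglongrightarrow> h y" if "y \<in> Y" for y
    by (rule metric_tendsto_imp_tendsto[OF LIMSEQ_inverse_real_of_nat])
      (use g(2)[OF that] less_imp_le in \<open>auto intro!: always_eventually simp: dist_real_def\<close>)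
  have "(\<lambda>n. f (g n *v x)) \<longlonglongrightarrow> h x" for x
  proof -
    obtain w where w: "\<And>f. f \<in> quintics \<Longrightarrow> f x = (\<Sum>y\<in>Y. w y * f y)" using Y(2) by blast
    have "f (g n *v x) = (\<Sum>y\<in>Y. w y * f (g n *v y))" for n
      using w[OF forms_change_coords[OF f]] .
    moreover have "(\<lambda>n. \<Sum>y\<in>Y. w y * f (g n *v y)) \<longlonglongrightarrow> (\<Sum>y\<in>Y. w y * h y)"
      by (intro tendsto_intros Ylim)
    ultimately show ?thesis using w[OF h(1)] by simp
  qed
  with g(1) that show ?thesis by blast
qed

subsection \<open>A criterion for closed orbits\<close>

lemma tendsto_matrix_vector_mult:
  fixes g :: "'a \<Rightarrow> complex ^ 'n ^ 'm"
  assumes "(g \<longlongrightarrow> k) F" "(x \<longlongrightarrow> y) F"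
  shows "((\<lambda>n. g n *v x n) \<longlongrightarrow> k *v y) F"
  unfolding matrix_vector_mult_def
  by (intro tendsto_intros tendsto_vec_lambda tendsto_vec_nth assms)

lemma tendsto_det:
  fixes g :: "'a \<Rightarrow> complex ^ 'n ^ 'n"
  assumes "(g \<longlongrightarrow> k) F" shows "((\<lambda>n. det (g n)) \<longlongrightarrow> det k) F"
  unfolding det_def by (intro tendsto_intros tendsto_vec_nth assms)

lemma bounded_subsequence:
  fixes g :: "nat \<Rightarrow> 'a::heine_borel"
  assumes "bounded (range g)"
  obtains r :: "nat \<Rightarrow> nat" and k where "strict_mono r" "(\<lambda>n. g (r n)) \<longlonglongrightarrow> k"
  using bounded_imp_convergent_subsequence[OF assms] by (auto simp: o_def)

text \<open>A properness criterion. The matrices \<open>g'\<close> give the same quintics as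
  \<open>g\<close> and serve to cancel a noncompact stabiliser. If their norms do not tend to
  infinity, some subsequence converges, and its limit has determinant 1 and carries \<open>f\<close>
  to \<open>h\<close>.\<close>

lemma closed_orbitI:
  assumes f: "f \<in> quintics"
    and proper: "\<And>g h. (\<And>n::nat. det (g n) = 1) \<Longrightarrow> (\<And>x. (\<lambda>n. f (g n *v x)) \<longlonglongrightarrow> h x) \<Longrightarrow>
      \<exists>g'. (\<forall>n. det (g' n) = 1 \<and> (\<forall>x. f (g' n *v x) = f (g n *v x))) \<and>
        \<not> filterlim (\<lambda>n. norm (g' n)) at_top sequentially"
  shows "closed_orbit f"
proof -
  have "h \<in> SL5_orbit f" if h: "h \<in> quintics" "h \<in> closure (SL5_orbit f)" for h
  proof -
    obtain g where g: "\<And>n. det (g n) = 1" "\<And>x. (\<lambda>n. f (g n *v x)) \<longlonglongrightarrow> h x"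
      using closure_orbit_sequence[OF f h] by blast
    obtain g' where g': "\<And>n. det (g' n) = 1" "\<And>n x. f (g' n *v x) = f (g n *v x)"
      and ninf: "\<not> filterlim (\<lambda>n. norm (g' n)) at_top sequentially"
      using proper[of g h] g by blast
    obtain B where "\<exists>\<^sub>F n in sequentially. norm (g' n) < B"
      using ninf unfolding filterlim_at_top by (auto simp: frequently_def not_less)
    then have "infinite {n. norm (g' n) < B}"
      using frequently_cofinite[of "\<lambda>n. norm (g' n) < B"] unfolding cofinite_eq_sequentially by blast
    from infinite_enumerate[OF this]
    obtain r :: "nat \<Rightarrow> nat" where r: "strict_mono r" "\<And>n. norm (g' (r n)) < B" by auto
    then have "bounded (range (\<lambda>n. g' (r n)))"
      unfolding bounded_iff by (intro exI[of _ B]) (auto intro: less_imp_le)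
    then obtain r' k where k: "strict_mono r'" "(\<lambda>n. g' (r (r' n))) \<longlonglongrightarrow> k"
      by (rule bounded_subsequence)
    have "det k = 1"
      using tendsto_det[OF k(2)] by (simp add: g'(1) LIMSEQ_const_iff)
    moreover have "h x = f (k *v x)" for x
    proof -
      have "(\<lambda>n. f (g' (r (r' n)) *v x)) \<longlonglongrightarrow> f (k *v x)"
        by (intro forms_tendsto[OF f] tendsto_matrix_vector_mult k(2) tendsto_const)
      moreover have "(\<lambda>n. f (g' (r (r' n)) *v x)) \<longlonglongrightarrow> h x"
        using LIMSEQ_subseq_LIMSEQ[OF g(2)[of x] strict_mono_o[OF r(1) k(1)]]
        by (simp add: o_def g'(2))
      ultimately show ?thesis using LIMSEQ_unique by blast
    qed
    ultimately show ?thesis by (auto simp: SL5_orbit_def change_coords_def)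
  qed
  then have "SL5_orbit f = quintics \<inter> closure (SL5_orbit f)"
    using SL5_orbit_quintics[OF f] closure_subset by blast
  then show ?thesis unfolding closed_orbit_def closedin_closed by blast
qed

subsection \<open>Vectors and matrices\<close>

definition vec5 :: "'a \<Rightarrow> 'a \<Rightarrow> 'a \<Rightarrow> 'a \<Rightarrow> 'a \<Rightarrow> 'a ^ 5" where
  "vec5 a b c d e =
     (\<chi> i. if i = 0 then a else if i = 1 then b else if i = 2 then c else if i = 3 then d else e)"

lemma vec5_nth [simp]:
  "vec5 a b c d e $ 0 = a" "vec5 a b c d e $ 1 = b" "vec5 a b c d e $ 2 = c"
  "vec5 a b c d e $ 3 = d" "vec5 a b c d e $ 4 = e"
  by (simp_all add: vec5_def)

text \<open>Left multiplication by a diagonal matrix: in the action by substitution it is applied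
  after \<open>g\<close>, which is where stabilisers of the quintic act.\<close>

definition scale_rows :: "(5 \<Rightarrow> complex) \<Rightarrow> complex ^ 5 ^ 5 \<Rightarrow> complex ^ 5 ^ 5" where
  "scale_rows c g = (\<chi> i. c i *s g $ i)"

lemma det_scale_rows: "det (scale_rows c g) = (\<Prod>i\<in>UNIV. c i) * det g"
  unfolding scale_rows_def by (subst det_rows_mul) simp

lemma scale_rows_mult [simp]: "(scale_rows c g *v x) $ i = c i * (g *v x) $ i"
  by (simp add: scale_rows_def matrix_vector_mult_def sum_distrib_left mult.assoc)

lemma matrix_entry: "g $ i $ j = (g *v axis j 1) $ i" for g :: "complex ^ 5 ^ 5"
  by (simp add: matrix_vector_mult_def axis_def if_distrib cong: if_cong)

lemma row_nonzero:
  fixes g :: "complex ^ 5 ^ 5"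
  assumes "det g = 1" shows "g $ i \<noteq> 0"
  using assms det_zero_row(2)[of i g] by (auto simp: row_def vec_eq_iff)

text \<open>The moment curve \<open>(s, s\<^sup>2, \<dots>, s\<^sup>5)\<close> meets an affine hyperplane in finitely many points.\<close>

lemma generic_point:
  fixes x :: cpoint
  assumes "finite L" "0 \<notin> L" "finite K" "0 \<notin> K"
  obtains y :: cpoint where "\<And>l k. l \<in> L \<Longrightarrow> k \<in> K \<Longrightarrow> (\<Sum>i\<in>UNIV. l $ i * (x + k *s y) $ i) \<noteq> 0"
proof -
  define Y :: "complex \<Rightarrow> cpoint" where "Y s = vec5 s (s^2) (s^3) (s^4) (s^5)" for s
  define Z where "Z l k = {s. (\<Sum>i\<in>UNIV. l $ i * (x + k *s Y s) $ i) = 0}" for l k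
  have "finite (Z l k)" if "l \<in> L" "k \<in> K" for l k
  proof -
    \<comment> \<open>The value of the linear form \<open>l\<close> at \<open>x + k *s Y s\<close>,
      as a polynomial in \<open>s\<close>. Since \<open>l\<close> and \<open>k\<close> are nonzero,
      so is one of the nonconstant coefficients.\<close>
    define p where "p = [:\<Sum>i\<in>UNIV. l $ i * x $ i, k * l $ 0, k * l $ 1, k * l $ 2, k * l $ 3, k * l $ 4:]"
    have "l \<noteq> 0" "k \<noteq> 0" using that assms by auto
    then have "p \<noteq> 0" by (auto simp: p_def vec_eq_iff forall_5)
    moreover have "Z l k = {s. poly p s = 0}"
      unfolding Z_def p_def sum_5 Y_def
      by (intro Collect_cong arg_cong[of _ _ "\<lambda>t. t = 0"])
        (simp add: algebra_simps eval_nat_numeral)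
    ultimately show ?thesis using poly_roots_finite by simp
  qed
  then have "finite (\<Union>l\<in>L. \<Union>k\<in>K. Z l k)" using assms by blast
  then obtain s where "s \<notin> (\<Union>l\<in>L. \<Union>k\<in>K. Z l k)"
    using ex_new_if_finite infinite_UNIV_char_0 by blast
  then show ?thesis by (intro that[of "Y s"]) (auto simp: Z_def)
qed

subsection \<open>Ternary cubics\<close>

text \<open>Vectors are considered modulo the coordinates \<open>0\<close> and \<open>1\<close> here.\<close>

definition dot3 :: "cpoint \<Rightarrow> cpoint \<Rightarrow> complex" where
  "dot3 u v = u $ 2 * v $ 2 + u $ 3 * v $ 3 + u $ 4 * v $ 4"

definition cross :: "cpoint \<Rightarrow> cpoint \<Rightarrow> cpoint" where
  "cross u v = vec5 0 0 (u $ 3 * v $ 4 - u $ 4 * v $ 3) (u $ 4 * v $ 2 - u $ 2 * v $ 4)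
     (u $ 2 * v $ 3 - u $ 3 * v $ 2)"

definition null3 :: "cpoint \<Rightarrow> bool" where
  "null3 u \<longleftrightarrow> u $ 2 = 0 \<and> u $ 3 = 0 \<and> u $ 4 = 0"

definition conj3 :: "cpoint \<Rightarrow> cpoint" where
  "conj3 u = vec5 0 0 (cnj (u $ 2)) (cnj (u $ 3)) (cnj (u $ 4))"

text \<open>Over the complex numbers \<open>dot3\<close> has isotropic vectors; conjugating one
  argument gives the definite hermitian form, so \<open>conj3 u\<close> is a covector that does not
  vanish on \<open>u\<close>.\<close>

lemma dot3_conj3_eq_0: "dot3 (conj3 u) u = 0 \<Longrightarrow> null3 u"
proof -
  assume "dot3 (conj3 u) u = 0"
  then have "complex_of_real ((cmod (u $ 2))\<^sup>2 + (cmod (u $ 3))\<^sup>2 + (cmod (u $ 4))\<^sup>2) = 0"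
    unfolding of_real_add complex_norm_square by (simp add: dot3_def conj3_def mult.commute)
  then have "(cmod (u $ 2))\<^sup>2 + (cmod (u $ 3))\<^sup>2 + (cmod (u $ 4))\<^sup>2 = 0"
    using of_real_eq_0_iff by blast
  then have "(cmod (u $ 2))\<^sup>2 = 0 \<and> (cmod (u $ 3))\<^sup>2 = 0 \<and> (cmod (u $ 4))\<^sup>2 = 0"
    by (smt (verit) zero_le_power2)
  then show ?thesis by (simp add: null3_def)
qed

text \<open>Cramer's rule: up to the triple product \<open>N\<close>, the cross products of pairs
  form the dual basis of \<open>u\<close>, \<open>v\<close>, \<open>w\<close>.\<close>

lemma null3_if_orthogonal_frame:
  assumes "dot3 x u = 0" "dot3 x v = 0" "dot3 x w = 0" "dot3 u (cross v w) \<noteq> 0"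
  shows "null3 x"
proof -
  define N where "N = dot3 u (cross v w)"
  have "N * x $ i = dot3 x u * cross v w $ i + dot3 x v * cross w u $ i + dot3 x w * cross u v $ i"
    if "i \<in> {2, 3, 4}" for i
    using that by (auto simp: N_def dot3_def cross_def algebra_simps)
  then have "N * x $ i = 0" if "i \<in> {2, 3, 4}" for i using that assms by simp
  then show ?thesis using assms(4) by (auto simp: null3_def N_def)
qed

text \<open>\<open>G\<close> is the gradient of \<open>q\<close>.\<close>

definition polar_of :: "cform \<Rightarrow> (cpoint \<Rightarrow> cpoint) \<Rightarrow> bool" where
  "polar_of q G \<longleftrightarrow> (\<forall>i. (\<lambda>x. G x $ i) \<in> forms {2, 3, 4} 2) \<and>
     (\<forall>x y. q (x + y) = q x + dot3 (G x) y + dot3 (G y) x + q y)"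

lemma forms_coord_mult: "i \<in> S \<Longrightarrow> j \<in> S \<Longrightarrow> (\<lambda>x. x $ i * x $ j) \<in> forms S 2"
  by (rule forms_mult'[OF forms_coord forms_coord]) simp_all

lemma forms_coord_power: "i \<in> S \<Longrightarrow> (\<lambda>x. x $ i ^ n) \<in> forms S n"
  by (rule forms_power'[OF forms_coord])

text \<open>\<open>G\<close> consists of the partial derivatives, computed from the ten
  coefficients. The symmetric expansion is Taylor's formula: for a cubic, the term quadratic in
  \<open>y\<close> is linear in \<open>x\<close> and equals \<open>dot3 (G y) x\<close>.\<close>

lemma ternary_cubic_polar:
  assumes "q \<in> forms {2, 3, 4} 3" obtains G where "polar_of q G"
proof -
  have "q \<in> forms {2, 3, 4} (Suc (Suc (Suc 0)))" using assms by (simp add: numeral_3_eq_3)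
  then obtain u v where uv: "u \<in> forms {2, 3, 4} (Suc (Suc 0))" "v \<in> forms {3, 4} (Suc (Suc (Suc 0)))"
    "q = (\<lambda>x. x $ 2 * u x + v x)" by (rule forms_insertE)
  from uv(1) obtain k w where kw: "k \<in> forms {2, 3, 4} (Suc 0)" "w \<in> forms {3, 4} (Suc (Suc 0))"
    "u = (\<lambda>x. x $ 2 * k x + w x)" by (rule forms_insertE)
  from kw(1) obtain a l where l: "l \<in> forms {3, 4} (Suc 0)" "k = (\<lambda>x. a * x $ 2 + l x)"
    by (rule forms_1_insertE)
  from l(1) obtain b c where bc: "l = (\<lambda>x. b * x $ 3 + c * x $ 4)" by (rule binary_linear)
  have "w \<in> forms {3, 4} 2" using kw(2) by (simp add: numeral_2_eq_2)
  then obtain d e f where de: "w = (\<lambda>x. d * (x $ 3)^2 + e * x $ 3 * x $ 4 + f * (x $ 4)^2)"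
    by (rule binary_quadratic)
  have "v \<in> forms {3, 4} 3" using uv(2) by (simp add: numeral_3_eq_3)
  then obtain g h i j where gh:
    "v = (\<lambda>x. g * (x $ 3)^3 + h * (x $ 3)^2 * x $ 4 + i * x $ 3 * (x $ 4)^2 + j * (x $ 4)^3)"
    by (rule binary_cubic)
  define G :: "cpoint \<Rightarrow> cpoint" where "G x = vec5 0 0
     (3 * a * (x $ 2)^2 + 2 * b * (x $ 2 * x $ 3) + 2 * c * (x $ 2 * x $ 4) + d * (x $ 3)^2 + e * (x $ 3 * x $ 4) + f * (x $ 4)^2)
     (b * (x $ 2)^2 + 2 * d * (x $ 2 * x $ 3) + e * (x $ 2 * x $ 4) + 3 * g * (x $ 3)^2 + 2 * h * (x $ 3 * x $ 4) + i * (x $ 4)^2)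
     (c * (x $ 2)^2 + e * (x $ 2 * x $ 3) + 2 * f * (x $ 2 * x $ 4) + h * (x $ 3)^2 + 2 * i * (x $ 3 * x $ 4) + 3 * j * (x $ 4)^2)" for x
  have "\<forall>i. (\<lambda>x. G x $ i) \<in> forms {2, 3, 4} 2"
    unfolding forall_5 G_def vec5_nth
    by (intro conjI forms_zero forms_add forms_scale forms_coord_mult forms_coord_power) simp_all
  moreover have "q (x + y) = q x + dot3 (G x) y + dot3 (G y) x + q y" for x y
    unfolding uv(3) kw(3) l(2) bc de gh
    by (simp add: dot3_def G_def power2_eq_square power3_eq_cube algebra_simps)
  ultimately show ?thesis using that[of G] by (simp add: polar_of_def)
qed

lemma dot3_add_scale:
  "dot3 u (x + y) = dot3 u x + dot3 u y" "dot3 u (c *s x) = c * dot3 u x" "dot3 (c *s u) x = c * dot3 u x"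
  "dot3 u (- x) = - dot3 u x"
  by (simp_all add: dot3_def algebra_simps)

lemma polar_homogeneous:
  assumes "polar_of q G" shows "G (c *s x) = c^2 *s G x"
  using assms forms_homogeneous[where S = "{2, 3, 4}" and d = 2 and f = "\<lambda>x. G x $ i" for i]
  unfolding polar_of_def vec_eq_iff by simp

text \<open>The part of \<open>q (x + y)\<close> that is odd in \<open>y\<close> consists of the
  first-order term and \<open>q y\<close>. Derivatives thus become combinations of values, so they
  inherit convergence from \<open>q\<close>.\<close>

lemma polar_eq:
  assumes "q \<in> forms {2, 3, 4} 3" "polar_of q G"
  shows "dot3 (G x) y = (q (x + y) - q (x + (-1) *s y)) / 2 - q y"
proof -
  have pol: "\<And>x y. q (x + y) = q x + dot3 (G x) y + dot3 (G y) x + q y"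
    using assms(2) by (simp add: polar_of_def)
  have "q (x + (-1) *s y) = q x - dot3 (G x) y + dot3 (G y) x - q y"
    using forms_homogeneous[OF assms(1), of "-1" y] polar_homogeneous[OF assms(2), of "-1" y]
    unfolding pol by (simp add: dot3_add_scale)
  then show ?thesis by (simp add: pol field_simps)
qed

text \<open>Along the line through \<open>x\<close> in direction \<open>y\<close> the cubic is a
  polynomial of degree at most 3 in the parameter, so its fourth finite difference vanishes.\<close>

lemma third_difference:
  assumes "q \<in> forms {2, 3, 4} 3" "polar_of q G"
  shows "q x = 4 * q (x + 1 *s y) - 6 * q (x + 2 *s y) + 4 * q (x + 3 *s y) - q (x + 4 *s y)"
proof -
  have exp: "q (x + k *s y) = q x + k * dot3 (G x) y + k^2 * dot3 (G y) x + k^3 * q y" for k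
    using assms(2) forms_homogeneous[OF assms(1), of k y] polar_homogeneous[OF assms(2), of k y]
    by (simp add: polar_of_def dot3_add_scale)
  show ?thesis unfolding exp[of 1] exp[of 2] exp[of 3] exp[of 4] by (simp add: algebra_simps)
qed

lemma binary_quadratic_zero:
  fixes a b c :: complex
  obtains s t where "(s, t) \<noteq> (0, 0)" "a * s^2 + b * s * t + c * t^2 = 0"
proof (cases "a = 0")
  case True
  then show ?thesis using that[of 1 0] by simp
next
  case False
  define s where "s = (- b + csqrt (b^2 - 4 * a * c)) / (2 * a)"
  have "2 * a * s + b = csqrt (b^2 - 4 * a * c)" using False by (simp add: s_def)
  then have "(2 * a * s + b)^2 = b^2 - 4 * a * c" by simp
  then have "4 * a * (a * s^2 + b * s + c) = 0" by (simp add: power2_eq_square algebra_simps)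
  then show ?thesis using False that[of s 1] by simp
qed

text \<open>A smooth plane cubic contains no line: the derivative of \<open>q\<close> transversal to the line is a
  quadratic form on it, whose zeros would be singular points.\<close>

lemma smooth_cubic_no_line:
  assumes q: "q \<in> forms {2, 3, 4} 3" "polar_of q G" and smooth: "\<And>p. null3 (G p) \<Longrightarrow> null3 p"
    and line: "\<And>s t. q (s *s u + t *s w) = 0"
  shows "null3 (cross u w)"
proof (rule ccontr)
  assume non: "\<not> null3 (cross u w)"
  \<comment> \<open>A covector that completes \<open>u\<close> and \<open>w\<close> to a frame, so a
    gradient orthogonal to all three must be null.\<close>
  define z where "z = conj3 (cross u w)"
  have N: "dot3 z (cross u w) \<noteq> 0" using non dot3_conj3_eq_0 by (auto simp: z_def)
  have G: "(\<lambda>x. G x $ i) \<in> forms {2, 3, 4} 2" for i using q(2) by (simp add: polar_of_def)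
  have "(\<lambda>x. dot3 z (G x)) \<in> forms {2, 3, 4} 2" unfolding dot3_def by (intro forms_add forms_scale G)
  \<comment> \<open>The coordinates 3 and 4 serve as parameters on the line, which makes the
    transversal derivative a binary quadratic form.\<close>
  then have "(\<lambda>x :: cpoint. dot3 z (G (x $ 3 *s u + x $ 4 *s w))) \<in> forms {3, 4} 2"
  proof (rule forms_subst)
    have "(\<lambda>x. u $ i * x $ 3 + w $ i * x $ 4) \<in> forms {3, 4} (Suc 0)" for i
      by (intro forms_add forms_scale forms_coord) simp_all
    then show "(\<lambda>x. (x $ 3 *s u + x $ 4 *s w) $ i) \<in> forms {3, 4} (Suc 0)" for i
      by (simp add: mult.commute)
  qed
  then obtain a b c where abc: "(\<lambda>x :: cpoint. dot3 z (G (x $ 3 *s u + x $ 4 *s w))) =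
      (\<lambda>x. a * (x $ 3)^2 + b * x $ 3 * x $ 4 + c * (x $ 4)^2)" by (rule binary_quadratic)
  obtain s t where st: "(s, t) \<noteq> (0, 0)" "a * s^2 + b * s * t + c * t^2 = 0"
    by (rule binary_quadratic_zero)
  define p where "p = s *s u + t *s w"
  have "dot3 z (G p) = 0" using fun_cong[OF abc, of "vec5 0 0 0 s t"] st(2) by (simp add: p_def)
  moreover have "dot3 (G p) r = 0" if "r = u \<or> r = w" for r
  proof -
    have "\<exists>s t. p + k *s r = s *s u + t *s w" for k
    proof -
      have "p + k *s u = (s + k) *s u + t *s w" "p + k *s w = s *s u + (t + k) *s w"
        by (simp_all add: p_def vec_eq_iff algebra_simps)
      then show ?thesis using that by blast
    qed
    then have "q (p + k *s r) = 0" for k using line by metis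
    from this[of 1] this[of "-1"] have "q (p + r) = 0" "q (p + (-1) *s r) = 0" by simp_all
    moreover have "q r = 0" using that line[of 1 0] line[of 0 1] by auto
    ultimately show ?thesis using polar_eq[OF q] by simp
  qed
  ultimately have "null3 (G p)"
    using N by (intro null3_if_orthogonal_frame[of _ z u w]) (auto simp: dot3_def mult.commute)
  then have p0: "null3 p" by (rule smooth)
  \<comment> \<open>If \<open>p\<close> were null, both parameters would annihilate the nonzero
    vector \<open>cross u w\<close>.\<close>
  have "s * cross u w $ i = cross p w $ i" "t * cross u w $ i = cross u p $ i"
    if "i \<in> {2, 3, 4}" for i
    using that by (auto simp: p_def cross_def algebra_simps)
  moreover have "cross p w $ i = 0" "cross u p $ i = 0" if "i \<in> {2, 3, 4}" for i
    using that p0 by (auto simp: null3_def cross_def)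
  ultimately have "s * cross u w $ i = 0" "t * cross u w $ i = 0" if "i \<in> {2, 3, 4}" for i
    using that by simp_all
  then show False using st(1) non by (auto simp: null3_def)
qed

subsection \<open>Closed orbits\<close>

lemma scale_rows_of_real: "scale_rows (\<lambda>_. of_real c) g = c *\<^sub>R g"
  unfolding scale_rows_def vec_eq_iff vector_scaleR_component
  by (simp add: scaleR_conv_of_real[where 'a = complex])

lemma matrix_vector_tendsto_coord:
  fixes g :: "'a \<Rightarrow> complex ^ 5 ^ 5"
  assumes "((\<lambda>n. g n $ i) \<longlongrightarrow> l) F"
  shows "((\<lambda>n. (g n *v x) $ i) \<longlongrightarrow> (\<Sum>j\<in>UNIV. l $ j * x $ j)) F"
  unfolding matrix_vector_mult_def vec_lambda_beta by (intro tendsto_intros tendsto_vec_nth assms)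

text \<open>Where the linear forms \<open>l, m\<close> do not vanish, the values of the cubic can be recovered from
  those of the quintic; the remaining points are reached by third differences.\<close>

lemma convergent_cubic_factor:
  fixes g :: "nat \<Rightarrow> complex ^ 5 ^ 5"
  assumes q: "q \<in> forms {2, 3, 4} 3" "polar_of q G"
    and l: "(\<lambda>n. g n $ 0) \<longlonglongrightarrow> l" "l \<noteq> 0" and m: "(\<lambda>n. g n $ 1) \<longlonglongrightarrow> m" "m \<noteq> 0"
    and conv: "\<And>x. (\<lambda>n. (g n *v x) $ 0 * (g n *v x) $ 1 * q (g n *v x)) \<longlonglongrightarrow> h x"
  shows "convergent (\<lambda>n. q (g n *v x))"
proof -
  define ev where "ev l x = (\<Sum>j\<in>UNIV. l $ j * x $ j)" for l x :: cpoint
  \<comment> \<open>A direction for which the four shifted points used by the finite difference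
    avoid both limiting hyperplanes.\<close>
  obtain y where y: "\<And>v k. v \<in> {l, m} \<Longrightarrow> k \<in> {1, 2, 3, 4} \<Longrightarrow> ev v (x + k *s y) \<noteq> 0"
    using generic_point[of "{l, m}" "{1, 2, 3, 4}" x] l(2) m(2) unfolding ev_def by auto
  have *: "convergent (\<lambda>n. q (g n *v z))" if z: "ev l z \<noteq> 0" "ev m z \<noteq> 0" for z
  proof -
    have l': "(\<lambda>n. (g n *v z) $ 0) \<longlonglongrightarrow> ev l z" and m': "(\<lambda>n. (g n *v z) $ 1) \<longlonglongrightarrow> ev m z"
      unfolding ev_def by (intro matrix_vector_tendsto_coord l m)+
    have "(\<lambda>n. (g n *v z) $ 0 * (g n *v z) $ 1 * q (g n *v z) / ((g n *v z) $ 0 * (g n *v z) $ 1))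
        \<longlonglongrightarrow> h z / (ev l z * ev m z)"
      using z by (intro tendsto_intros conv l' m') simp
    moreover have "\<forall>\<^sub>F n in sequentially.
        (g n *v z) $ 0 * (g n *v z) $ 1 * q (g n *v z) / ((g n *v z) $ 0 * (g n *v z) $ 1) = q (g n *v z)"
      using tendsto_imp_eventually_ne[OF l' z(1)] tendsto_imp_eventually_ne[OF m' z(2)]
      by eventually_elim simp
    ultimately have "(\<lambda>n. q (g n *v z)) \<longlonglongrightarrow> h z / (ev l z * ev m z)"
      by (rule Lim_transform_eventually)
    then show ?thesis by (rule convergentI)
  qed
  have c: "convergent (\<lambda>n. q (g n *v (x + k *s y)))" if "k \<in> {1, 2, 3, 4}" for k
    using y[OF _ that] by (intro *) simp_all
  have "q (g n *v x) = 4 * q (g n *v (x + 1 *s y)) - 6 * q (g n *v (x + 2 *s y))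
      + 4 * q (g n *v (x + 3 *s y)) - q (g n *v (x + 4 *s y))" for n
    using third_difference[OF q, of "g n *v x" "g n *v y"]
    unfolding matrix_vector_right_distrib vector_scalar_commute .
  then show ?thesis
    by (simp only:) (intro convergent_diff convergent_add convergent_mult convergent_const c; simp)
qed

definition frame_matrix :: "cpoint \<Rightarrow> cpoint \<Rightarrow> cpoint \<Rightarrow> complex ^ 5 ^ 5" where
  "frame_matrix a b c = vec5 (axis 0 1) (axis 1 1) (vec5 0 0 (a $ 2) (a $ 3) (a $ 4))
     (vec5 0 0 (b $ 2) (b $ 3) (b $ 4)) (vec5 0 0 (c $ 2) (c $ 3) (c $ 4))"

lemma frame_matrix_mult [simp]:
  "(frame_matrix a b c *v x) $ 0 = x $ 0" "(frame_matrix a b c *v x) $ 1 = x $ 1"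
  "(frame_matrix a b c *v x) $ 2 = dot3 a x" "(frame_matrix a b c *v x) $ 3 = dot3 b x"
  "(frame_matrix a b c *v x) $ 4 = dot3 c x"
  by (simp_all add: frame_matrix_def matrix_vector_mult_def sum_5 axis_def dot3_def)

lemma tendsto_vec5:
  assumes "(a \<longlongrightarrow> a') F" "(b \<longlongrightarrow> b') F" "(c \<longlongrightarrow> c') F" "(d \<longlongrightarrow> d') F" "(e \<longlongrightarrow> e') F"
  shows "((\<lambda>n. vec5 (a n) (b n) (c n) (d n) (e n)) \<longlongrightarrow> vec5 a' b' c' d' e') F"
proof (rule vec_tendstoI)
  fix i :: 5
  show "((\<lambda>n. vec5 (a n) (b n) (c n) (d n) (e n) $ i) \<longlongrightarrow> vec5 a' b' c' d' e' $ i) F"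
    using exhaust_5[of i] assms by auto
qed

lemma tendsto_dot3:
  assumes "(u \<longlongrightarrow> a) F" "(v \<longlongrightarrow> b) F" shows "((\<lambda>n. dot3 (u n) (v n)) \<longlongrightarrow> dot3 a b) F"
  unfolding dot3_def by (intro tendsto_intros tendsto_vec_nth assms)

text \<open>The triple product of the three rows is, by the Binet-Cauchy identity and
  \<open>dot3 v p = 0\<close>, the product of the squared hermitian norms of \<open>p\<close> and
  \<open>v\<close>.\<close>

lemma det_frame_matrix:
  assumes "\<not> null3 p" "\<not> null3 v" "dot3 v p = 0"
  shows "det (frame_matrix (conj3 p) (cross (conj3 v) p) v) \<noteq> 0"
proof -
  let ?K = "frame_matrix (conj3 p) (cross (conj3 v) p) v"
  have "x = 0" if "?K *v x = 0" for x
  proof -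
    have "(?K *v x) $ i = 0" for i using that by simp
    from this[of 0] this[of 1] this[of 2] this[of 3] this[of 4]
    have x: "x $ 0 = 0" "x $ 1 = 0" "dot3 (conj3 p) x = 0" "dot3 (cross (conj3 v) p) x = 0"
      "dot3 v x = 0" by simp_all
    have "dot3 (conj3 p) (cross (cross (conj3 v) p) v) =
        dot3 (conj3 p) p * dot3 (conj3 v) v - dot3 v p * dot3 (conj3 p) (conj3 v)"
      by (simp add: dot3_def cross_def algebra_simps)
    also have "\<dots> \<noteq> 0" using assms dot3_conj3_eq_0 by auto
    finally have "null3 x"
      using x by (intro null3_if_orthogonal_frame[of _ "conj3 p" "cross (conj3 v) p" v])
        (simp_all add: dot3_def mult.commute)
    then show ?thesis using x by (simp add: vec_eq_iff forall_5 null3_def)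
  qed
  then have "invertible ?K" by (simp add: invertible_left_inverse matrix_left_invertible_ker)
  then show ?thesis by (simp add: invertible_det_nz)
qed

text \<open>If the matrices \<open>g n\<close> diverge, their directions converge to a matrix \<open>A\<close> on whose image the
  smooth cubic \<open>q\<close> vanishes, so that this image is spanned by a single point \<open>p\<close> of the curve.
  In a frame consisting of the dual of \<open>p\<close>, a linear form \<open>u\<close> vanishing at \<open>p\<close>, and the tangent of the curve,
  the rows of \<open>g n\<close> have sizes \<open>O(d)\<close>, \<open>o(d)\<close>, \<open>O(d\<^sup>-\<^sup>2)\<close>, where \<open>d = norm (g n)\<close>. So the determinant
  tends to 0.\<close>

lemma smooth_cubic_no_divergence:
  fixes g :: "nat \<Rightarrow> complex ^ 5 ^ 5"
  assumes q: "q \<in> forms {2, 3, 4} 3" "polar_of q G" and smooth: "\<And>p. null3 (G p) \<Longrightarrow> null3 p"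
    and det: "\<And>n. det (g n) = 1"
    and l: "(\<lambda>n. g n $ 0) \<longlonglongrightarrow> l" and m: "(\<lambda>n. g n $ 1) \<longlonglongrightarrow> m"
    and conv: "\<And>x. convergent (\<lambda>n. q (g n *v x))"
    and inf: "filterlim (\<lambda>n. norm (g n)) at_top sequentially"
    and A: "(\<lambda>n. (1 / norm (g n)) *\<^sub>R g n) \<longlonglongrightarrow> A"
  shows False
proof -
  define d where "d n = norm (g n)" for n
  define e :: "nat \<Rightarrow> complex" where "e n = of_real (1 / d n)" for n
  have dpos: "d n > 0" for n
    using row_nonzero[OF det] by (auto simp: d_def vec_eq_iff)
  have "(\<lambda>n. 1 / d n) \<longlonglongrightarrow> 0"
    using inf unfolding d_def by (intro real_tendsto_divide_at_top[OF tendsto_const])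
  then have "(\<lambda>n. complex_of_real (1 / d n)) \<longlonglongrightarrow> of_real 0" by (rule tendsto_of_real)
  then have e0: "e \<longlonglongrightarrow> 0" by (simp add: e_def[abs_def])
  have e: "e n \<noteq> 0" for n using dpos[of n] by (simp add: e_def)
  define gA where "gA n = scale_rows (\<lambda>_. e n) (g n)" for n
  have gA: "gA \<longlonglongrightarrow> A" using A unfolding gA_def e_def scale_rows_of_real d_def .
  have gAx: "gA n *v x = e n *s (g n *v x)" for n x by (simp add: gA_def vec_eq_iff)
  have gAlim: "(\<lambda>n. gA n *v x) \<longlonglongrightarrow> A *v x" for x
    by (intro tendsto_matrix_vector_mult gA tendsto_const)
  have "norm (gA n) = 1" for n
    using dpos[of n] unfolding gA_def e_def scale_rows_of_real by (simp add: d_def)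
  then have "norm A = 1" using tendsto_norm[OF gA] by (simp add: LIMSEQ_const_iff)
  then obtain v0 where v0: "A *v v0 \<noteq> 0"
    by (metis matrix_eq matrix_vector_mult_0 norm_zero zero_neq_one)
  \<comment> \<open>Convergent rows are negligible against the norm, so \<open>A\<close> has its
    image in the last three coordinates.\<close>
  have row0: "(A *v x) $ i = 0" if "(\<lambda>n. g n $ i) \<longlonglongrightarrow> r" for x r i
  proof -
    have "(\<lambda>n. e n * (g n *v x) $ i) \<longlonglongrightarrow> 0 * (\<Sum>j\<in>UNIV. r $ j * x $ j)"
      by (intro tendsto_mult e0 matrix_vector_tendsto_coord that)
    then have "(\<lambda>n. (gA n *v x) $ i) \<longlonglongrightarrow> 0" by (simp add: gAx)
    then show ?thesis using tendsto_vec_nth[OF gAlim] LIMSEQ_unique by blast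
  qed
  have qA: "q (A *v x) = 0" for x
  proof -
    obtain c where c: "(\<lambda>n. q (g n *v x)) \<longlonglongrightarrow> c" using conv by (auto simp: convergent_def)
    have "(\<lambda>n. e n ^ 3 * q (g n *v x)) \<longlonglongrightarrow> 0 ^ 3 * c" by (intro tendsto_intros e0 c)
    then have "(\<lambda>n. q (gA n *v x)) \<longlonglongrightarrow> 0" by (simp add: gAx forms_homogeneous[OF q(1)])
    then show ?thesis using forms_tendsto[OF q(1) gAlim] LIMSEQ_unique by blast
  qed
  define p where "p = A *v v0"
  have p: "\<not> null3 p"
  proof
    assume "null3 p"
    then have "p = 0"
      using row0[OF l] row0[OF m] by (simp add: vec_eq_iff forall_5 null3_def p_def)
    then show False using v0 by (simp add: p_def)
  qed
  have pA: "null3 (cross p (A *v x))" for x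
  proof (rule smooth_cubic_no_line[OF q smooth])
    fix s t
    have "s *s p + t *s (A *v x) = A *v (s *s v0 + t *s x)"
      by (simp add: p_def matrix_vector_right_distrib vector_scalar_commute)
    then show "q (s *s p + t *s (A *v x)) = 0" using qA by simp
  qed
  define v where "v = G p"
  have v: "\<not> null3 v" using smooth p by (auto simp: v_def)
  \<comment> \<open>Euler's relation: \<open>polar_eq\<close> with both arguments \<open>p\<close>
    gives \<open>3 * q p\<close>, and \<open>p\<close> lies on the curve.\<close>
  have vp: "dot3 v p = 0"
  proof -
    have "p + p = 2 *s p" "p + (-1) *s p = 0 *s p" by (simp_all add: vec_eq_iff)
    then have "dot3 v p = (q (2 *s p) - q (0 *s p)) / 2 - q p"
      using polar_eq[OF q, of p p] unfolding v_def by (simp only:)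
    moreover have "q (c *s p) = 0" for c
      using forms_homogeneous[OF q(1), of c p] qA[of v0] by (simp add: p_def)
    from this[of 2] this[of 0] this[of 1] have "q (2 *s p) = 0" "q (0 *s p) = 0" "q p = 0"
      by (simp_all only: vec.scale_one)
    ultimately show ?thesis by (simp only:) simp
  qed
  define u where "u = cross (conj3 v) p"
  have uA: "dot3 u (A *v x) = 0" for x
  proof -
    have "dot3 u (A *v x) = dot3 (conj3 v) (cross p (A *v x))"
      by (simp add: u_def dot3_def cross_def algebra_simps)
    then show ?thesis using pA[of x] by (simp add: dot3_def null3_def)
  qed
  \<comment> \<open>The gradient is taken at the approximating point, not at \<open>p\<close>: only
    then is the last row an expression in values of \<open>q\<close> along the sequence
    itself.\<close>
  define vn where "vn n = G (gA n *v v0)" for n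
  have vn: "vn \<longlonglongrightarrow> v"
    unfolding vn_def v_def p_def using q(2) gAlim
    by (intro vec_tendstoI) (auto simp: polar_of_def intro: forms_tendsto)
  define K where "K n = frame_matrix (conj3 p) u (vn n)" for n
  have "K \<longlonglongrightarrow> frame_matrix (conj3 p) u v"
    unfolding K_def frame_matrix_def by (intro tendsto_vec5 tendsto_const tendsto_vec_nth vn)
  then have Klim: "(\<lambda>n. det (K n)) \<longlonglongrightarrow> det (frame_matrix (conj3 p) u v)" by (rule tendsto_det)
  \<comment> \<open>The scaling compensates the expected row sizes. Its factors multiply to 1, so it
    does not change the determinant.\<close>
  define R where "R n = scale_rows (\<lambda>i. vec5 1 1 (e n) (e n) (1 / e n ^ 2) $ i) (K n ** g n)" for n
  have detR: "det (R n) = det (K n)" for n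
    using e[of n] by (simp add: R_def det_scale_rows det_mul det prod_5 power2_eq_square)
  have r2: "(\<lambda>n. (R n *v x) $ 2) \<longlonglongrightarrow> dot3 (conj3 p) (A *v x)" for x
  proof -
    have "(\<lambda>n. dot3 (conj3 p) (gA n *v x)) \<longlonglongrightarrow> dot3 (conj3 p) (A *v x)"
      by (intro tendsto_dot3 tendsto_const gAlim)
    then show ?thesis
      by (simp add: R_def K_def gAx dot3_add_scale flip: matrix_vector_mul_assoc)
  qed
  have r3: "(\<lambda>n. (R n *v x) $ 3) \<longlonglongrightarrow> 0" for x
  proof -
    have "(\<lambda>n. dot3 u (gA n *v x)) \<longlonglongrightarrow> dot3 u (A *v x)"
      by (intro tendsto_dot3 tendsto_const gAlim)
    then show ?thesis
      by (simp add: R_def K_def gAx dot3_add_scale uA flip: matrix_vector_mul_assoc)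
  qed
  have r4: "convergent (\<lambda>n. (R n *v x) $ 4)" for x
  proof -
    \<comment> \<open>\<open>G\<close> is quadratic, so the factor \<open>e n ^ 2\<close> from
      rescaling its argument cancels the weight of this row.\<close>
    have "(R n *v x) $ 4 = dot3 (G (g n *v v0)) (g n *v x)" for n
      using e[of n]
      by (simp add: R_def K_def vn_def gAx polar_homogeneous[OF q(2)] dot3_add_scale
          flip: matrix_vector_mul_assoc)
    then have "(R n *v x) $ 4 = 1 / 2 * (q (g n *v (v0 + x)) - q (g n *v (v0 + (-1) *s x))) - q (g n *v x)" for n
      unfolding polar_eq[OF q] matrix_vector_right_distrib vector_scalar_commute by (simp only:) simp
    then show ?thesis
      by (simp only:) (intro convergent_diff convergent_mult convergent_const conv)
  qed
  have r01: "(\<lambda>n. (R n *v x) $ 0) \<longlonglongrightarrow> (\<Sum>j\<in>UNIV. l $ j * x $ j)"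
    "(\<lambda>n. (R n *v x) $ 1) \<longlonglongrightarrow> (\<Sum>j\<in>UNIV. m $ j * x $ j)" for x
    using matrix_vector_tendsto_coord[OF l, of x] matrix_vector_tendsto_coord[OF m, of x]
    by (simp_all add: R_def K_def flip: matrix_vector_mul_assoc)
  have "\<exists>c. (\<lambda>n. (R n *v x) $ i) \<longlonglongrightarrow> c \<and> (i = 3 \<longrightarrow> c = 0)" for i x
    using exhaust_5[of i] r01[of x] r2[of x] r3[of x] r4[of x] by (auto simp: convergent_def)
  then have "\<forall>i j. \<exists>c. (\<lambda>n. R n $ i $ j) \<longlonglongrightarrow> c \<and> (i = 3 \<longrightarrow> c = 0)"
    unfolding matrix_entry by blast
  then obtain c where c: "\<And>i j. (\<lambda>n. R n $ i $ j) \<longlonglongrightarrow> c i j" "\<And>j. c 3 j = 0" by metis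
  \<comment> \<open>The limit has a zero row, whereas \<open>det (K n)\<close> tends to the nonzero
    determinant of the limiting frame.\<close>
  define R' :: "complex ^ 5 ^ 5" where "R' = (\<chi> i j. c i j)"
  have "R \<longlonglongrightarrow> R'" by (intro vec_tendstoI) (simp add: R'_def c)
  then have "(\<lambda>n. det (K n)) \<longlonglongrightarrow> det R'" using tendsto_det[of R] by (simp add: detR)
  moreover have "det R' = 0"
    using det_zero_row(2)[of 3 R'] by (simp add: R'_def c(2) row_def zero_vec_def)
  ultimately have "det (frame_matrix (conj3 p) u v) = 0" using Klim LIMSEQ_unique by metis
  then show False using det_frame_matrix[OF p v vp] by (simp add: u_def)
qed

lemma of_real_smult_vec: "of_real c *s v = c *\<^sub>R v" for v :: "complex ^ 'n"
  unfolding vec_eq_iff vector_scaleR_component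
  by (simp add: scaleR_conv_of_real[where 'a = complex])

lemma quintic_with_cubic_factor:
  assumes "q \<in> forms {2, 3, 4} 3" shows "(\<lambda>x. x $ 0 * x $ 1 * q x) \<in> quintics"
  by (rule forms_mult'[OF forms_coord_mult forms_mono[OF assms]]) simp_all

lemma closed_orbit_smooth_cubic:
  assumes q: "q \<in> forms {2, 3, 4} 3" "polar_of q G" and smooth: "\<And>p. null3 (G p) \<Longrightarrow> null3 p"
  shows "closed_orbit (\<lambda>x. x $ 0 * x $ 1 * q x)"
proof (rule closed_orbitI[OF quintic_with_cubic_factor[OF q(1)]])
  fix g :: "nat \<Rightarrow> complex ^ 5 ^ 5" and h
  assume det: "\<And>n. det (g n) = 1"
    and lim: "\<And>x. (\<lambda>n. (g n *v x) $ 0 * (g n *v x) $ 1 * q (g n *v x)) \<longlonglongrightarrow> h x"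
  define a b where "a n = norm (g n $ 0)" and "b n = norm (g n $ 1)" for n
  \<comment> \<open>With \<open>k n ^ 3 = a n * b n\<close> the factor gained by the cubic
    compensates those lost by the first two coordinates, and the same equation keeps the determinant
    1.\<close>
  define k where "k n = root 3 (a n * b n)" for n
  have pos: "a n > 0" "b n > 0" for n using row_nonzero[OF det] by (simp_all add: a_def b_def)
  then have k3: "k n ^ 3 = a n * b n" for n by (simp add: k_def odd_real_root_pow)
  then have k3': "complex_of_real (k n) ^ 3 = of_real (a n) * of_real (b n)" for n
    by (metis of_real_mult of_real_power)
  define g' where "g' n = scale_rows
      (\<lambda>i. vec5 (of_real (1 / a n)) (of_real (1 / b n)) (of_real (k n)) (of_real (k n)) (of_real (k n)) $ i)
      (g n)" for n
  have det': "det (g' n) = 1" for n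
    using pos[of n] k3'[of n] by (simp add: g'_def det_scale_rows det prod_5 power3_eq_cube)
  have inv: "(g' n *v x) $ 0 * (g' n *v x) $ 1 * q (g' n *v x) =
      (g n *v x) $ 0 * (g n *v x) $ 1 * q (g n *v x)" for n x
  proof -
    have "q (g' n *v x) = q (of_real (k n) *s (g n *v x))"
      by (rule forms_cong_coords[OF q(1)]) (auto simp: g'_def)
    also have "\<dots> = of_real (a n) * of_real (b n) * q (g n *v x)"
      by (simp add: forms_homogeneous[OF q(1)] k3')
    finally show ?thesis using pos[of n] by (simp add: g'_def)
  qed
  have "\<not> filterlim (\<lambda>n. norm (g' n)) at_top sequentially"
  proof
    assume inf: "filterlim (\<lambda>n. norm (g' n)) at_top sequentially"
    have n01: "norm (g' n $ 0) = 1" "norm (g' n $ 1) = 1" for n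
    proof -
      have "g' n $ 0 = (1 / a n) *\<^sub>R g n $ 0" "g' n $ 1 = (1 / b n) *\<^sub>R g n $ 1"
        by (simp_all only: g'_def scale_rows_def vec_lambda_beta vec5_nth of_real_smult_vec)
      then show "norm (g' n $ 0) = 1" "norm (g' n $ 1) = 1"
        using pos[of n] by (simp_all add: a_def b_def)
    qed
    \<comment> \<open>Three bounded sequences in one, so that a single subsequence serves all. The
      unit rows have nonzero limits, as the recovery of the cubic values requires.\<close>
    define T where "T n = (g' n $ 0, g' n $ 1, (1 / norm (g' n)) *\<^sub>R g' n)" for n
    have "range T \<subseteq> cball 0 1 \<times> (cball 0 1 \<times> cball 0 1)"
      using n01 by (auto simp: T_def)
    then have "bounded (range T)"
      using bounded_subset bounded_Times bounded_cball by metis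
    then obtain r t where r: "strict_mono r" "(\<lambda>n. T (r n)) \<longlonglongrightarrow> t" by (rule bounded_subsequence)
    obtain l m A where t: "t = (l, m, A)" by (cases t)
    have l: "(\<lambda>n. g' (r n) $ 0) \<longlonglongrightarrow> l" and m: "(\<lambda>n. g' (r n) $ 1) \<longlonglongrightarrow> m"
      and A: "(\<lambda>n. (1 / norm (g' (r n))) *\<^sub>R g' (r n)) \<longlonglongrightarrow> A"
      using tendsto_fst[OF r(2)] tendsto_fst[OF tendsto_snd[OF r(2)]]
        tendsto_snd[OF tendsto_snd[OF r(2)]] by (simp_all add: T_def t)
    have "norm l = 1" "norm m = 1"
      using tendsto_norm[OF l] tendsto_norm[OF m] by (simp_all add: n01 LIMSEQ_const_iff)
    then have "l \<noteq> 0" "m \<noteq> 0" by auto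
    moreover have "(\<lambda>n. (g' (r n) *v x) $ 0 * (g' (r n) *v x) $ 1 * q (g' (r n) *v x)) \<longlonglongrightarrow> h x" for x
      using LIMSEQ_subseq_LIMSEQ[OF lim[of x] r(1)] by (simp add: inv o_def)
    ultimately have conv: "convergent (\<lambda>n. q (g' (r n) *v x))" for x
      by (intro convergent_cubic_factor[OF q l _ m])
    show False
      using filterlim_compose[OF inf filterlim_subseq[OF r(1)]]
      by (intro smooth_cubic_no_divergence[OF q _ det' l m conv _ A]) (simp_all add: smooth)
  qed
  with det' inv show "\<exists>g'. (\<forall>n. det (g' n) = 1 \<and> (\<forall>x. (g' n *v x) $ 0 * (g' n *v x) $ 1 * q (g' n *v x) =
      (g n *v x) $ 0 * (g n *v x) $ 1 * q (g n *v x))) \<and> \<not> filterlim (\<lambda>n. norm (g' n)) at_top sequentially"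
    by (intro exI[of _ g'] conjI allI)
qed

section \<open>Five independent hyperplanes\<close>

lemma product_of_coordinates_quintic: "(\<lambda>x. c * (x $ 0 * x $ 1 * x $ 2 * x $ 3 * x $ 4)) \<in> quintics"
proof (rule forms_scale)
  have "(\<lambda>x. \<Prod>i\<in>UNIV. x $ i) \<in> forms UNIV (\<Sum>i\<in>(UNIV :: 5 set). 1)"
    by (rule forms_prod) (auto intro: forms_coord)
  then show "(\<lambda>x. x $ 0 * x $ 1 * x $ 2 * x $ 3 * x $ 4) \<in> quintics" by (simp add: prod_5)
qed

text \<open>The torus of determinant 1 balances the five rows of a matrix, and their common norm \<open>N\<close> is then
  controlled by the value of the product of the rows at a generic point, which grows like \<open>N\<^sup>5\<close>.\<close>

lemma closed_orbit_five_hyperplanes: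
  assumes c: "c \<noteq> 0"
  shows "closed_orbit (\<lambda>x. c * (x $ 0 * x $ 1 * x $ 2 * x $ 3 * x $ 4))" (is "closed_orbit ?f")
proof (rule closed_orbitI[OF product_of_coordinates_quintic])
  fix g :: "nat \<Rightarrow> complex ^ 5 ^ 5" and h
  assume det: "\<And>n. det (g n) = 1" and lim: "\<And>x. (\<lambda>n. ?f (g n *v x)) \<longlonglongrightarrow> h x"
  have f: "?f x = c * (\<Prod>i\<in>UNIV. x $ i)" for x by (simp add: prod_5)
  define a where "a n i = norm (g n $ i)" for n i
  \<comment> \<open>The geometric mean of the row norms, so that the factors
    \<open>N n / a n i\<close> have product 1.\<close>
  define N where "N n = root 5 (\<Prod>i\<in>UNIV. a n i)" for n
  have pos: "a n i > 0" for n i using row_nonzero[OF det] by (simp add: a_def)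
  have N5: "N n ^ 5 = (\<Prod>i\<in>UNIV. a n i)" for n by (simp add: N_def odd_real_root_pow)
  have N0: "N n > 0" for n using pos by (simp add: N_def prod_pos)
  define u where "u n = scale_rows (\<lambda>i. of_real (1 / a n i)) (g n)" for n
  define g' where "g' n = scale_rows (\<lambda>_. of_real (N n)) (u n)" for n
  have prod1: "(\<Prod>i\<in>UNIV. complex_of_real (N n) * of_real (1 / a n i)) = 1" for n
  proof -
    have "(\<Prod>i\<in>(UNIV :: 5 set). N n * (1 / a n i)) = N n ^ 5 / (\<Prod>i\<in>UNIV. a n i)"
      by (simp add: prod_dividef)
    also have "\<dots> = 1" using pos[of n] by (simp add: N5 less_imp_neq[symmetric] prod_zero_iff)
    finally show ?thesis by (metis (no_types, lifting) of_real_1 of_real_mult of_real_prod prod.cong)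
  qed
  have det': "det (g' n) = 1" for n
    using prod1[of n] by (simp only: g'_def u_def det_scale_rows det prod.distrib mult_1_right)
  have inv: "?f (g' n *v x) = ?f (g n *v x)" for n x
  proof -
    have "(\<Prod>i\<in>UNIV. (g' n *v x) $ i) =
        (\<Prod>i\<in>UNIV. (complex_of_real (N n) * of_real (1 / a n i)) * (g n *v x) $ i)"
      by (simp add: g'_def u_def mult.assoc)
    also have "\<dots> = (\<Prod>i\<in>UNIV. (g n *v x) $ i)" by (subst prod.distrib) (simp only: prod1 mult_1_left)
    finally show ?thesis unfolding f by simp
  qed
  have ui: "norm (u n $ i) = 1" for n i
  proof -
    have "u n $ i = (1 / a n i) *\<^sub>R g n $ i"
      by (simp only: u_def scale_rows_def vec_lambda_beta of_real_smult_vec)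
    then show ?thesis using pos[of n i] by (simp add: a_def)
  qed
  have u_le: "norm (u n) \<le> 5" for n
  proof -
    have "norm (u n) \<le> (\<Sum>i\<in>UNIV. norm (u n $ i))" by (simp add: norm_vec_def L2_set_le_sum)
    then show ?thesis by (simp add: ui)
  qed
  have "\<not> filterlim (\<lambda>n. norm (g' n)) at_top sequentially"
  proof
    assume inf: "filterlim (\<lambda>n. norm (g' n)) at_top sequentially"
    have "bounded (range u)" unfolding bounded_iff using u_le by blast
    then obtain r U where r: "strict_mono r" "(\<lambda>n. u (r n)) \<longlonglongrightarrow> U" by (rule bounded_subsequence)
    have "norm (U $ i) = 1" for i
      using tendsto_norm[OF tendsto_vec_nth[OF r(2), of i]] by (simp add: ui LIMSEQ_const_iff)
    then have "U $ i \<noteq> 0" for i by (metis norm_zero zero_neq_one)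
    then have "0 \<notin> range (($) U)" by (metis rangeE)
    \<comment> \<open>A point off the five limiting hyperplanes, so the product of unit rows stays
      away from 0 there and convergence of the quintics bounds \<open>N\<close>.\<close>
    then obtain y :: cpoint where
      "\<And>l k. l \<in> range (($) U) \<Longrightarrow> k \<in> {1} \<Longrightarrow> (\<Sum>j\<in>UNIV. l $ j * (0 + k *s y) $ j) \<noteq> 0"
      using generic_point[of "range (($) U)" "{1}" 0] by auto
    from this[OF rangeI, of 1] have "(\<Sum>j\<in>UNIV. U $ i $ j * y $ j) \<noteq> 0" for i by simp
    then have Uy: "(\<Prod>i\<in>UNIV. (U *v y) $ i) \<noteq> 0"
      by (simp add: matrix_vector_mult_def prod_zero_iff)
    define v where "v n = c * (\<Prod>i\<in>UNIV. (u (r n) *v y) $ i)" for n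
    have v: "v \<longlonglongrightarrow> c * (\<Prod>i\<in>UNIV. (U *v y) $ i)"
      unfolding v_def by (intro tendsto_intros tendsto_vec_nth tendsto_matrix_vector_mult r(2))
    have "?f (g' (r n) *v y) = of_real (N (r n)) ^ 5 * v n" for n
      by (simp add: v_def g'_def prod_5 eval_nat_numeral)
    then have "(\<lambda>n. of_real (N (r n)) ^ 5 * v n) \<longlonglongrightarrow> h y"
      using LIMSEQ_subseq_LIMSEQ[OF lim[of y] r(1)] by (simp add: inv o_def)
    then have "(\<lambda>n. of_real (N (r n)) ^ 5 * v n / v n) \<longlonglongrightarrow> h y / (c * (\<Prod>i\<in>UNIV. (U *v y) $ i))"
      using Uy c by (intro tendsto_divide v) auto
    moreover have "\<forall>\<^sub>F n in sequentially. of_real (N (r n)) ^ 5 * v n / v n = complex_of_real (N (r n)) ^ 5"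
      using tendsto_imp_eventually_ne[OF v, of 0] Uy c by (auto elim: eventually_mono)
    ultimately have "(\<lambda>n. complex_of_real (N (r n)) ^ 5) \<longlonglongrightarrow> h y / (c * (\<Prod>i\<in>UNIV. (U *v y) $ i))"
      by (rule Lim_transform_eventually)
    then have "Bseq (\<lambda>n. complex_of_real (N (r n)) ^ 5)" by (intro convergent_imp_Bseq convergentI)
    then obtain B where B: "\<And>n. norm (complex_of_real (N (r n)) ^ 5) \<le> B" by (auto simp: Bseq_def)
    have "norm (g' (r n)) \<le> 5 * (1 + B)" for n
    proof -
      have "N (r n) \<le> 1 + N (r n) ^ 5"
      proof (cases "N (r n) \<le> 1")
        case True
        then show ?thesis using N0[of "r n"] by (smt (verit) zero_less_power)
      next
        case False
        then show ?thesis using self_le_power[of "N (r n)" 5] by simp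
      qed
      also have "\<dots> \<le> 1 + B" using B[of n] N0[of "r n"] by (simp add: norm_power)
      finally have "N (r n) * norm (u (r n)) \<le> (1 + B) * 5"
        using u_le N0[of "r n"] by (intro mult_mono) auto
      then show ?thesis using N0[of "r n"] by (simp add: g'_def scale_rows_of_real)
    qed
    moreover have "\<forall>\<^sub>F n in sequentially. norm (g' (r n)) \<ge> 5 * (1 + B) + 1"
      using filterlim_compose[OF inf filterlim_subseq[OF r(1)]] by (auto simp: filterlim_at_top)
    ultimately show False by (auto simp: eventually_sequentially) (smt (verit) order_refl)
  qed
  with det' inv show "\<exists>g'. (\<forall>n. det (g' n) = 1 \<and> (\<forall>x. ?f (g' n *v x) = ?f (g n *v x))) \<and>
      \<not> filterlim (\<lambda>n. norm (g' n)) at_top sequentially"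
    by (intro exI[of _ g'] conjI allI)
qed

text \<open>Move the singular point to \<open>(1, 0, 0)\<close>.\<close>

lemma singular_cubic_SS1:
  assumes q: "q \<in> forms {2, 3, 4} 3" "polar_of q G" and p: "null3 (G p)" "\<not> null3 p"
  shows "of_type SS1_VIII (\<lambda>x. x $ 0 * x $ 1 * q x)"
proof -
  \<comment> \<open>A complement of the line through \<open>p\<close>, obtained by dropping one
    coordinate in which \<open>p\<close> is nonzero; \<open>x2\<close> becomes the coordinate along
    \<open>p\<close>.\<close>
  define Y :: "cpoint \<Rightarrow> cpoint" where "Y x = (if p $ 2 \<noteq> 0 then vec5 0 0 0 (x $ 3) (x $ 4)
    else if p $ 3 \<noteq> 0 then vec5 0 0 (x $ 3) 0 (x $ 4) else vec5 0 0 (x $ 3) (x $ 4) 0)" for x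
  define L :: "cpoint \<Rightarrow> cpoint" where "L x = vec5 (x $ 0) (x $ 1) (p $ 2 * x $ 2 + Y x $ 2)
    (p $ 3 * x $ 2 + Y x $ 3) (p $ 4 * x $ 2 + Y x $ 4)" for x
  have Y: "(\<lambda>x. Y x $ i) \<in> forms {3, 4} (Suc 0)" for i
    using exhaust_5[of i]
    by (cases "p $ 2 = 0"; cases "p $ 3 = 0") (auto simp: Y_def forms_zero intro: forms_coord)
  have YU: "(\<lambda>x. Y x $ i) \<in> forms UNIV (Suc 0)" for i by (rule forms_mono[OF Y]) simp
  have "\<forall>i. (\<lambda>x. L x $ i) \<in> forms UNIV (Suc 0)"
    unfolding forall_5 L_def vec5_nth by (intro conjI forms_add forms_scale forms_coord YU) simp_all
  then have L: "(\<lambda>x. L x $ i) \<in> forms UNIV (Suc 0)" for i by blast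
  have "dot3 (G p) y = 0" for y using p(1) by (simp add: dot3_def null3_def)
  \<comment> \<open>The term quadratic in \<open>x $ 2\<close> carries the gradient at
    \<open>p\<close> and drops out.\<close>
  then have "q (x $ 2 *s p + Y x) = x $ 2 ^ 3 * q p + (x $ 2 * dot3 (G (Y x)) p + q (Y x))" for x
    using q(2) by (simp add: polar_of_def forms_homogeneous[OF q(1)] polar_homogeneous[OF q(2)] dot3_add_scale)
  moreover have "q p = 0"
  proof -
    have "p + p = 2 *s p" "p + (-1) *s p = 0 *s p" by (simp_all add: vec_eq_iff)
    then have "0 = (q (2 *s p) - q (0 *s p)) / 2 - q p"
      using polar_eq[OF q, of p p] \<open>dot3 (G p) p = 0\<close> by (simp only:)
    then show ?thesis by (simp only: forms_homogeneous[OF q(1)]) simp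
  qed
  moreover have "q (L x) = q (x $ 2 *s p + Y x)" for x
    by (rule forms_cong_coords[OF q(1)]) (auto simp: L_def mult.commute)
  ultimately have qL: "q (L x) = x $ 2 * dot3 (G (Y x)) p + q (Y x)" for x by simp
  show ?thesis
  proof (rule of_typeI[OF L])
    have "(\<lambda>x. G (Y x) $ i) \<in> forms {3, 4} 2" for i
      using q(2) by (intro forms_subst[OF _ Y, of "\<lambda>x. G x $ i" "{2, 3, 4}"]) (simp_all add: polar_of_def)
    then have "(\<lambda>x. p $ 2 * G (Y x) $ 2 + p $ 3 * G (Y x) $ 3 + p $ 4 * G (Y x) $ 4) \<in> forms {3, 4} 2"
      by (intro forms_add forms_scale)
    then have "(\<lambda>x. dot3 (G (Y x)) p) \<in> forms {3, 4} 2" by (simp add: dot3_def mult.commute)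
    moreover have "(\<lambda>x. q (Y x)) \<in> forms {3, 4} 3" by (rule forms_subst[OF q(1) Y])
    ultimately show "(\<lambda>x. L x $ 0 * L x $ 1 * q (L x)) \<in> SS1_VIII"
      unfolding SS1_VIII_def qL by (auto simp: L_def)
  next
    fix x assume "L x = 0"
    then have "L x $ i = 0" for i by simp
    from this[of 0] this[of 1] this[of 2] this[of 3] this[of 4] show "x = 0"
      using p(2) by (auto simp: L_def Y_def null3_def vec_eq_iff forall_5 split: if_splits)
  qed
qed

subsection \<open>Degenerations\<close>

text \<open>\<open>F\<close> extends the translates by a one-parameter subgroup across
  \<open>t = 0\<close>, where the matrices themselves may have poles.\<close>

lemma torus_limit:
  assumes det: "\<And>t. t \<noteq> 0 \<Longrightarrow> (\<Prod>i\<in>UNIV. c t $ i) = 1"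
    and F: "\<And>t x. t \<noteq> 0 \<Longrightarrow> f (\<chi> i. c t $ i * x $ i) = F t x"
    and cont: "\<And>x. isCont (\<lambda>t. F t x) (0 :: complex)"
  shows "F 0 \<in> closure (SL5_orbit f)"
proof -
  define t where "t n = complex_of_real (inverse (real (Suc n)))" for n
  define g where "g n = scale_rows (\<lambda>i. c (t n) $ i) (mat 1)" for n
  have t: "t n \<noteq> 0" for n by (simp add: t_def del: of_nat_Suc)
  have "t \<longlonglongrightarrow> of_real 0" unfolding t_def by (intro tendsto_of_real LIMSEQ_inverse_real_of_nat)
  then have t0: "t \<longlonglongrightarrow> 0" by simp
  have "g n *v x = (\<chi> i. c (t n) $ i * x $ i)" for n x
    by (simp add: g_def vec_eq_iff)
  then have "f (g n *v x) = F (t n) x" for n x using F[OF t] by simp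
  moreover have "(\<lambda>n. F (t n) x) \<longlonglongrightarrow> F 0 x" for x
    using isCont_tendsto_compose[OF cont t0] .
  moreover have "det (g n) = 1" for n using det[OF t] by (simp add: g_def det_scale_rows)
  ultimately show ?thesis by (intro orbit_limit_in_closure) auto
qed

section \<open>Instability of US1-VIII\<close>

lemma linear_functional_sum:
  assumes L: "linear_functional L" and "finite K" "\<And>k. k \<in> K \<Longrightarrow> m k \<in> quintics"
  shows "L (\<lambda>x. \<Sum>k\<in>K. a k * m k x) = (\<Sum>k\<in>K. a k * L (m k))"
  using assms(2,3)
proof (induction K rule: finite_induct)
  case empty
  have "\<forall>c. \<forall>f\<in>quintics. L (\<lambda>x. c * f x) = c * L f"
    using L unfolding linear_functional_def by blast
  from this[rule_format, OF forms_zero, of 0] show ?case by simp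
next
  case (insert k K)
  have "L (\<lambda>x. a k * m k x + (\<Sum>k\<in>K. a k * m k x)) =
      L (\<lambda>x. a k * m k x) + L (\<lambda>x. \<Sum>k\<in>K. a k * m k x)"
    using L insert unfolding linear_functional_def by (simp add: forms_scale forms_sum)
  moreover have "L (\<lambda>x. a k * m k x) = a k * L (m k)"
    using L insert unfolding linear_functional_def by simp
  ultimately show ?case using insert by simp
qed

text \<open>The easy direction of the Hilbert-Mumford criterion. Along the torus an invariant keeps
  its value but is a polynomial in \<open>t\<close>; as all weights and the degree are positive,
  this polynomial vanishes at 0.\<close>

lemma unstable_if_positive_weights:
  assumes f: "f \<in> quintics" and K: "finite K" "\<And>k. k \<in> K \<Longrightarrow> k > 0" "\<And>k. k \<in> K \<Longrightarrow> m k \<in> quintics"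
    and det: "\<And>t. t \<noteq> 0 \<Longrightarrow> (\<Prod>i\<in>UNIV. c t $ i) = 1"
    and weights: "\<And>t x. t \<noteq> 0 \<Longrightarrow> f (\<chi> i. c t $ i * x $ i) = (\<Sum>k\<in>K. t ^ k * m k x)"
  shows "unstable f"
  unfolding unstable_def semistable_def
proof clarsimp
  fix d P assume d: "0 < d" and P: "homogeneous_polynomial d P" "SL5_invariant P"
  from P(1) obtain n :: nat and a L where L: "\<And>i j. i < n \<Longrightarrow> j < d \<Longrightarrow> linear_functional (L i j)"
    "\<And>f. f \<in> quintics \<Longrightarrow> P f = (\<Sum>i<n. a i * (\<Prod>j<d. L i j f))"
    unfolding homogeneous_polynomial_def by blast
  define Q where "Q t = (\<Sum>i<n. a i * (\<Prod>j<d. \<Sum>k\<in>K. t ^ k * L i j (m k)))" for t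
  have "P f = Q t" if t: "t \<noteq> 0" for t
  proof -
    define g where "g = scale_rows (\<lambda>i. c t $ i) (mat 1)"
    have "g *v x = (\<chi> i. c t $ i * x $ i)" for x by (simp add: g_def vec_eq_iff)
    then have g: "change_coords g f = (\<lambda>x. \<Sum>k\<in>K. t ^ k * m k x)"
      using weights[OF t] by (simp add: change_coords_def)
    have "det g = 1" using det[OF t] by (simp add: g_def det_scale_rows)
    then have "P f = P (change_coords g f)" using P(2) f by (simp add: SL5_invariant_def)
    also have "\<dots> = Q t"
      unfolding g Q_def using L(1) K
      by (subst L(2)) (auto intro!: forms_sum forms_scale sum.cong prod.cong simp: linear_functional_sum)
    finally show ?thesis .
  qed
  then have "\<forall>\<^sub>F t in at 0. P f = Q t" by (auto simp: eventually_at_filter)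
  moreover have "(Q \<longlongrightarrow> Q 0) (at 0)"
    unfolding Q_def by (intro tendsto_intros)
  ultimately have "((\<lambda>t::complex. P f) \<longlongrightarrow> Q 0) (at 0)" by (simp add: tendsto_cong)
  then have "P f = Q 0" by (simp add: tendsto_const_iff)
  also have "Q 0 = 0"
  proof -
    have "0 ^ k * L i j (m k) = 0" if "k \<in> K" for i j k using K(2)[OF that] by simp
    then have "(\<Sum>k\<in>K. 0 ^ k * L i j (m k)) = 0" for i j by (intro sum.neutral ballI)
    then show ?thesis using d by (simp add: Q_def zero_power)
  qed
  finally show "P f = 0" .
qed

lemma US1_form_unstable:
  assumes "f \<in> US1_VIII"
  shows "unstable f" "(\<lambda>_. 0) \<in> closure (SL5_orbit f)"
proof -
  from assms obtain q3 e where "q3 \<in> forms {3, 4} 3"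
    and f: "f = (\<lambda>x. x $ 0 * x $ 1 * (q3 x + e * x $ 2 * (x $ 4)^2))"
    unfolding US1_VIII_def by blast
  from this(1) obtain a b c d where q3:
    "q3 = (\<lambda>x. a * (x $ 3)^3 + b * (x $ 3)^2 * x $ 4 + c * x $ 3 * (x $ 4)^2 + d * (x $ 4)^3)"
    by (rule binary_cubic)
  \<comment> \<open>With weights (0, 0, -4, 1, 3) the term in \<open>x2 * x4^2\<close> gets weight 2
    and the monomials of \<open>q3\<close> get 3, 5, 7, 9; these weights index the components
    \<open>m\<close>.\<close>
  define w :: "complex \<Rightarrow> cpoint" where "w t = vec5 1 1 (1 / t ^ 4) t (t ^ 3)" for t
  define m :: "nat \<Rightarrow> cform" where "m k x = x $ 0 * x $ 1 *
    (if k = 2 then e * (x $ 2 * (x $ 4)^2) else if k = 3 then a * (x $ 3)^3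
     else if k = 5 then b * (x $ 4 * (x $ 3)^2) else if k = 7 then c * (x $ 3 * (x $ 4)^2)
     else d * (x $ 4)^3)" for k x
  have m: "m k \<in> quintics" for k
  proof -
    have mon: "(\<lambda>x. x $ i * x $ j ^ 2) \<in> forms UNIV 3" for i j :: 5
      by (rule forms_mult'[OF forms_coord forms_coord_power]) simp_all
    have "(\<lambda>x. if k = 2 then e * (x $ 2 * (x $ 4)^2) else if k = 3 then a * (x $ 3)^3
     else if k = 5 then b * (x $ 4 * (x $ 3)^2) else if k = 7 then c * (x $ 3 * (x $ 4)^2)
     else d * (x $ 4)^3) \<in> forms UNIV 3"
      by (cases "k = 2"; cases "k = 3"; cases "k = 5"; cases "k = 7")
        (simp_all add: forms_scale mon forms_coord_power)
    from forms_mult'[OF forms_coord_mult this, of 0 1 5] show ?thesis by (simp add: m_def[abs_def])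
  qed
  have det: "(\<Prod>i\<in>UNIV. w t $ i) = 1" if "t \<noteq> 0" for t
    using that by (simp add: w_def prod_5 eval_nat_numeral)
  have weights: "f (\<chi> i. w t $ i * x $ i) = (\<Sum>k\<in>{2, 3, 5, 7, 9}. t ^ k * m k x)" if "t \<noteq> 0" for t x
    using that by (simp add: f q3 w_def m_def eval_nat_numeral field_simps)
  have fs: "f = (\<lambda>x. \<Sum>k\<in>{2, 3, 5, 7, 9}. m k x)"
    by (simp add: f q3 m_def algebra_simps fun_eq_iff)
  have "f \<in> quintics" unfolding fs by (intro forms_sum m)
  then show "unstable f"
    by (rule unstable_if_positive_weights[OF _ _ _ _ det weights]) (auto intro: m)
  define F where "F t x = (\<Sum>k\<in>{2, 3, 5, 7, 9}. t ^ k * m k x)" for t x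
  have "F 0 \<in> closure (SL5_orbit f)"
  proof (rule torus_limit[OF det])
    show "isCont (\<lambda>t. F t x) 0" for x unfolding F_def by (intro continuous_intros)
    show "f (\<chi> i. w t $ i * x $ i) = F t x" if "t \<noteq> 0" for t x
      unfolding F_def by (rule weights[OF that])
  qed
  moreover have "F 0 = (\<lambda>_. 0)" by (simp add: F_def fun_eq_iff)
  ultimately show "(\<lambda>_. 0) \<in> closure (SL5_orbit f)" by simp
qed

lemma US1_scale: "h \<in> US1_VIII \<Longrightarrow> (\<lambda>x. k * h x) \<in> US1_VIII"
proof -
  assume "h \<in> US1_VIII"
  then obtain q3 c where q3: "q3 \<in> forms {3, 4} 3"
    "h = (\<lambda>x. x $ 0 * x $ 1 * (q3 x + c * x $ 2 * (x $ 4)^2))" unfolding US1_VIII_def by blast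
  then have "(\<lambda>x. k * h x) = (\<lambda>x. x $ 0 * x $ 1 * ((\<lambda>x. k * q3 x) x + (k * c) * x $ 2 * (x $ 4)^2))"
    by (simp add: algebra_simps)
  with forms_scale[OF q3(1), of k] show ?thesis unfolding US1_VIII_def
    by (intro CollectI exI[of _ "\<lambda>x. k * q3 x"] exI[of _ "k * c"] conjI)
qed

lemma US1_unstable:
  assumes "of_type US1_VIII f" "f \<in> quintics"
  shows "unstable f" "(\<lambda>_. 0) \<in> closure (SL5_orbit f)"
proof -
  obtain s where s: "det s = 1" "change_coords s f \<in> US1_VIII"
    using of_type_SL5E[OF assms US1_scale] by blast
  show "(\<lambda>_. 0) \<in> closure (SL5_orbit f)"
    using US1_form_unstable(2)[OF s(2)] by (simp add: SL5_orbit_change_coords[OF s(1)])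
  show "unstable f"
    using US1_form_unstable(1)[OF s(2)] s(1) assms(2)
    unfolding unstable_def semistable_def SL5_invariant_def by metis
qed

lemma change_coords_eq_0:
  assumes "det g = 1" "change_coords g f = (\<lambda>_. 0)" shows "f = (\<lambda>_. 0)"
proof -
  obtain k where "g ** k = mat 1"
    using assms(1) by (metis invertible_det_nz invertible_def zero_neq_one)
  then have "f x = change_coords g f (k *v x)" for x
    by (simp add: change_coords_def matrix_vector_mul_assoc)
  then show ?thesis using assms(2) by auto
qed

lemma US1_not_closed:
  assumes "of_type US1_VIII f" "f \<in> quintics" "f \<noteq> (\<lambda>_. 0)" shows "\<not> closed_orbit f"
proof
  assume "closed_orbit f"
  then have "(\<lambda>_. 0) \<in> SL5_orbit f"
    using closed_orbit_closureD forms_zero US1_unstable(2)[OF assms(1,2)] by blast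
  then obtain g where "det g = 1" "change_coords g f = (\<lambda>_. 0)" unfolding SL5_orbit_def by force
  then show False using change_coords_eq_0 assms(3) by blast
qed

section \<open>Members of MO2-IV\<close>

lemma of_type_ternary_substitution:
  assumes "A \<in> forms UNIV (Suc 0)" "B \<in> forms UNIV (Suc 0)" "C \<in> forms UNIV (Suc 0)"
    and "\<And>x. A x = 0 \<Longrightarrow> B x = 0 \<Longrightarrow> C x = 0 \<Longrightarrow> x $ 2 = 0 \<and> x $ 3 = 0 \<and> x $ 4 = 0"
    and "(\<lambda>x. f (vec5 (x $ 0) (x $ 1) (A x) (B x) (C x))) \<in> F"
  shows "of_type F f"
proof (rule of_typeI[where L = "\<lambda>x. vec5 (x $ 0) (x $ 1) (A x) (B x) (C x)"])
  have "\<forall>i. (\<lambda>x. vec5 (x $ 0) (x $ 1) (A x) (B x) (C x) $ i) \<in> forms UNIV (Suc 0)"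
    unfolding forall_5 vec5_nth using assms(1-3) forms_coord by blast
  then show "(\<lambda>x. vec5 (x $ 0) (x $ 1) (A x) (B x) (C x) $ i) \<in> forms UNIV (Suc 0)" for i by blast
  fix x assume "vec5 (x $ 0) (x $ 1) (A x) (B x) (C x) = 0"
  then have "vec5 (x $ 0) (x $ 1) (A x) (B x) (C x) $ i = 0" for i by simp
  from this[of 0] this[of 1] this[of 2] this[of 3] this[of 4] show "x = 0"
    using assms(4)[of x] by (simp add: vec_eq_iff forall_5)
qed (rule assms(5))

lemma linear_forms_UNIV:
  "(\<lambda>x. x $ i) \<in> forms UNIV (Suc 0)"
  "(\<lambda>x. a * x $ i) \<in> forms UNIV (Suc 0)"
  "(\<lambda>x. a * x $ i + b * x $ j) \<in> forms UNIV (Suc 0)"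
  "(\<lambda>x. a * x $ i + b * x $ j + c * x $ k) \<in> forms UNIV (Suc 0)"
  by (intro forms_add forms_scale forms_coord UNIV_I)+

lemma binary_quadratic_factorization:
  fixes a b c :: complex
  obtains \<alpha> \<beta> \<gamma> \<delta> where
    "\<And>x y. a * x^2 + b * x * y + c * y^2 = (\<alpha> * x + \<beta> * y) * (\<gamma> * x + \<delta> * y)"
proof -
  obtain s t where st: "(s, t) \<noteq> (0, 0)" "a * s^2 + b * s * t + c * t^2 = 0"
    by (rule binary_quadratic_zero)
  show ?thesis
  proof (cases "t = 0")
    case True
    then have "a = 0" using st by simp
    then show ?thesis by (intro that[of 0 1 b c]) (simp add: power2_eq_square algebra_simps)
  next
    case False
    define r where "r = s / t"
    have "a * r^2 + b * r + c = (a * s^2 + b * s * t + c * t^2) / t^2"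
      using False by (simp add: r_def field_simps power2_eq_square)
    then have c: "c = - a * r^2 - b * r" using st by (simp add: algebra_simps eq_neg_iff_add_eq_0)
    show ?thesis
      by (rule that[of 1 "- r" a "a * r + b"]) (simp add: c power2_eq_square algebra_simps)
  qed
qed

text \<open>The binary quadratic splits into two linear forms. Independent factors give five
  hyperplanes; proportional ones give a cubic in two linear forms, which is a member of US1-VIII
  with \<open>c = 0\<close>.\<close>

lemma MO2_cases:
  assumes "f \<in> MO2_IV" "f \<noteq> (\<lambda>_. 0)"
  shows "of_type five_hyperplanes f \<or> of_type US1_VIII f"
proof -
  from assms(1) obtain q2 where "q2 \<in> forms {2, 3} 2" and f: "f = (\<lambda>x. x $ 0 * x $ 1 * x $ 4 * q2 x)"
    unfolding MO2_IV_def by blast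
  from this(1) obtain a b c where "q2 = (\<lambda>x. a * (x $ 2)^2 + b * x $ 2 * x $ 3 + c * (x $ 3)^2)"
    by (rule binary_quadratic)
  moreover obtain \<alpha> \<beta> \<gamma> \<delta> where
    "\<And>x y. a * x^2 + b * x * y + c * y^2 = (\<alpha> * x + \<beta> * y) * (\<gamma> * x + \<delta> * y)"
    using binary_quadratic_factorization[of a b c] by blast
  ultimately have q2: "q2 = (\<lambda>x. (\<alpha> * x $ 2 + \<beta> * x $ 3) * (\<gamma> * x $ 2 + \<delta> * x $ 3))" by simp
  define D where "D = \<alpha> * \<delta> - \<beta> * \<gamma>"
  show ?thesis
  proof (cases "D = 0")
    case False
    have 1: "\<alpha> * (\<delta> / D * u + (- \<beta>) / D * v) + \<beta> * ((- \<gamma>) / D * u + \<alpha> / D * v) = u"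
      and 2: "\<gamma> * (\<delta> / D * u + (- \<beta>) / D * v) + \<delta> * ((- \<gamma>) / D * u + \<alpha> / D * v) = v" for u v
    proof -
      have "\<alpha> * (\<delta> / D * u + (- \<beta>) / D * v) + \<beta> * ((- \<gamma>) / D * u + \<alpha> / D * v) = D / D * u"
        "\<gamma> * (\<delta> / D * u + (- \<beta>) / D * v) + \<delta> * ((- \<gamma>) / D * u + \<alpha> / D * v) = D / D * v"
        unfolding D_def by (simp_all add: field_simps)
      with False show "\<alpha> * (\<delta> / D * u + (- \<beta>) / D * v) + \<beta> * ((- \<gamma>) / D * u + \<alpha> / D * v) = u"
        "\<gamma> * (\<delta> / D * u + (- \<beta>) / D * v) + \<delta> * ((- \<gamma>) / D * u + \<alpha> / D * v) = v" by simp_all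
    qed
    have "of_type five_hyperplanes f"
    proof (rule of_type_ternary_substitution)
      show "(\<lambda>x. \<delta> / D * x $ 2 + (- \<beta>) / D * x $ 3) \<in> forms UNIV (Suc 0)"
        "(\<lambda>x. (- \<gamma>) / D * x $ 2 + \<alpha> / D * x $ 3) \<in> forms UNIV (Suc 0)"
        "(\<lambda>x. x $ 4) \<in> forms UNIV (Suc 0)" by (rule linear_forms_UNIV)+
      show "x $ 2 = 0 \<and> x $ 3 = 0 \<and> x $ 4 = 0"
        if "\<delta> / D * x $ 2 + (- \<beta>) / D * x $ 3 = 0" "(- \<gamma>) / D * x $ 2 + \<alpha> / D * x $ 3 = 0" "x $ 4 = 0" for x
        using 1[of "x $ 2" "x $ 3"] 2[of "x $ 2" "x $ 3"] unfolding that by simp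
      show "(\<lambda>x. f (vec5 (x $ 0) (x $ 1) (\<delta> / D * x $ 2 + (- \<beta>) / D * x $ 3)
          ((- \<gamma>) / D * x $ 2 + \<alpha> / D * x $ 3) (x $ 4))) \<in> five_hyperplanes"
        unfolding f q2 vec5_nth 1 2 five_hyperplanes_def
        by (rule CollectI, rule exI[of _ 1]) (simp add: fun_eq_iff)
    qed
    then show ?thesis ..
  next
    case True
    have \<alpha>\<beta>: "\<alpha> \<noteq> 0 \<or> \<beta> \<noteq> 0" using assms(2) by (auto simp: f q2)
    have "\<exists>k. \<gamma> = k * \<alpha> \<and> \<delta> = k * \<beta>"
    proof (cases "\<alpha> = 0")
      case False
      with True show ?thesis by (intro exI[of _ "\<gamma> / \<alpha>"]) (simp add: D_def field_simps)
    next
      case a: True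
      with True \<alpha>\<beta> show ?thesis by (intro exI[of _ "\<delta> / \<beta>"]) (simp add: D_def)
    qed
    then obtain k where "\<gamma> = k * \<alpha>" "\<delta> = k * \<beta>" by blast
    then have q2: "q2 = (\<lambda>x. k * (\<alpha> * x $ 2 + \<beta> * x $ 3)^2)"
      by (simp add: q2 power2_eq_square algebra_simps)
    have US1: "(\<lambda>x. x $ 0 * x $ 1 * x $ 4 * (k * (x $ 3)^2)) \<in> US1_VIII"
    proof -
      have "(\<lambda>x. k * (x $ 4 * (x $ 3)^2)) \<in> forms {3, 4} 3"
        by (intro forms_scale forms_mult'[OF forms_coord forms_coord_power]) simp_all
      then show ?thesis unfolding US1_VIII_def
        by (intro CollectI exI[of _ "\<lambda>x. k * (x $ 4 * (x $ 3)^2)"] exI[of _ 0]) (simp add: fun_eq_iff)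
    qed
    have "of_type US1_VIII f"
    proof (cases "\<alpha> = 0")
      case False
      show ?thesis
      proof (rule of_type_ternary_substitution)
        show "(\<lambda>x. 1 / \<alpha> * x $ 3 + (- \<beta>) / \<alpha> * x $ 2) \<in> forms UNIV (Suc 0)"
          "(\<lambda>x. x $ 2) \<in> forms UNIV (Suc 0)" "(\<lambda>x. x $ 4) \<in> forms UNIV (Suc 0)"
          by (rule linear_forms_UNIV)+
        show "(\<lambda>x. f (vec5 (x $ 0) (x $ 1) (1 / \<alpha> * x $ 3 + (- \<beta>) / \<alpha> * x $ 2) (x $ 2) (x $ 4))) \<in> US1_VIII"
          using US1 False by (simp add: f q2 field_simps)
      qed (use False in auto)
    next
      case True
      show ?thesis
      proof (rule of_type_ternary_substitution)
        show "(\<lambda>x. x $ 2) \<in> forms UNIV (Suc 0)" "(\<lambda>x. 1 / \<beta> * x $ 3) \<in> forms UNIV (Suc 0)"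
          "(\<lambda>x. x $ 4) \<in> forms UNIV (Suc 0)" by (rule linear_forms_UNIV)+
        show "(\<lambda>x. f (vec5 (x $ 0) (x $ 1) (x $ 2) (1 / \<beta> * x $ 3) (x $ 4))) \<in> US1_VIII"
          using US1 True \<alpha>\<beta> by (simp add: f q2)
      qed (use True \<alpha>\<beta> in auto)
    qed
    then show ?thesis ..
  qed
qed

lemma exceptional_change_coords:
  "det g = 1 \<Longrightarrow> exceptional (change_coords g f) \<Longrightarrow> exceptional f"
  unfolding exceptional_def using of_type_change_coords by (metis invertible_det_nz zero_neq_one)

lemma MO2_scale: "h \<in> MO2_IV \<Longrightarrow> (\<lambda>x. k * h x) \<in> MO2_IV"
proof -
  assume "h \<in> MO2_IV"
  then obtain q2 where q2: "q2 \<in> forms {2, 3} 2" "h = (\<lambda>x. x $ 0 * x $ 1 * x $ 4 * q2 x)"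
    unfolding MO2_IV_def by blast
  then have "(\<lambda>x. k * h x) = (\<lambda>x. x $ 0 * x $ 1 * x $ 4 * (\<lambda>x. k * q2 x) x)" by (simp add: algebra_simps)
  with forms_scale[OF q2(1), of k] show ?thesis unfolding MO2_IV_def
    by (intro CollectI exI[of _ "\<lambda>x. k * q2 x"] conjI)
qed

text \<open>A closed orbit would contain \<open>h\<close>, so \<open>f\<close> would be of one of
  the two types in \<open>MO2_cases\<close>: the first is exceptional, and the second has 0 in its
  orbit closure.\<close>

lemma MO2_degeneration:
  assumes f: "f \<in> quintics" "f \<noteq> (\<lambda>_. 0)" "\<not> exceptional f"
    and h: "h \<in> quintics" "h \<in> closure (SL5_orbit f)" "h \<noteq> (\<lambda>_. 0)" "of_type MO2_IV h"
  shows "\<not> closed_orbit f \<and> degenerates_to MO2_IV f"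
proof
  show "degenerates_to MO2_IV f" using h unfolding degenerates_to_def by blast
  show "\<not> closed_orbit f"
  proof
    assume closed: "closed_orbit f"
    then have "h \<in> SL5_orbit f" using h closed_orbit_closureD by blast
    then obtain g where g: "det g = 1" "h = change_coords g f" unfolding SL5_orbit_def by blast
    obtain s where s: "det s = 1" "change_coords s h \<in> MO2_IV"
      using of_type_SL5E[OF h(4,1) MO2_scale] by blast
    have "change_coords s h \<noteq> (\<lambda>_. 0)" using change_coords_eq_0 s(1) h(3) by blast
    then have "of_type five_hyperplanes (change_coords s h) \<or> of_type US1_VIII (change_coords s h)"
      using MO2_cases s(2) by blast
    moreover have "of_type F f" if "of_type F (change_coords s h)" for F
      using that of_type_change_coords g s(1) by (metis invertible_det_nz zero_neq_one)
    ultimately show False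
      using f US1_not_closed closed unfolding exceptional_def by blast
  qed
qed

lemma degeneration_change_coords:
  assumes "det s = 1"
    and "\<not> closed_orbit (change_coords s f) \<and> degenerates_to F (change_coords s f)"
  shows "\<not> closed_orbit f \<and> degenerates_to F f"
  using assms by (simp add: closed_orbit_change_coords degenerates_to_def SL5_orbit_change_coords)

section \<open>Degenerations of SS2-VIII and SS1-VIII\<close>

lemma quintic_from_ternary: "q \<in> forms UNIV 3 \<Longrightarrow> (\<lambda>x. x $ 0 * x $ 1 * q x) \<in> quintics"
  by (rule forms_mult'[OF forms_coord_mult]) simp_all

lemma SS2_form_degeneration:
  assumes "f \<in> SS2_VIII" "f \<in> quintics" "f \<noteq> (\<lambda>_. 0)" "\<not> exceptional f"
  shows "\<not> closed_orbit f \<and> degenerates_to MO2_IV f"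
proof -
  from assms(1) obtain q2 q1 e where qs: "q2 \<in> forms {2, 3} 2" "q1 \<in> forms {2, 3} 1"
    and f: "f = (\<lambda>x. x $ 0 * x $ 1 * (q2 x * x $ 4 + q1 x * (x $ 4)^2 + e * (x $ 4)^3))"
    unfolding SS2_VIII_def by blast
  obtain a b c where q2: "q2 = (\<lambda>x. a * (x $ 2)^2 + b * x $ 2 * x $ 3 + c * (x $ 3)^2)"
    using qs(1) by (rule binary_quadratic)
  obtain \<alpha> \<beta> where q1: "q1 = (\<lambda>x. \<alpha> * x $ 2 + \<beta> * x $ 3)"
    using qs(2) binary_linear[of q1 2 3] by (metis One_nat_def)
  show ?thesis
  proof (cases "q2 = (\<lambda>_. 0)")
    case False
    \<comment> \<open>Weights (0, 0, -1, -1, 2) fix the term with \<open>q2\<close> and give the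
      other two terms weights 3 and 6.\<close>
    define w :: "complex \<Rightarrow> cpoint" where "w t = vec5 1 1 (1 / t) (1 / t) (t ^ 2)" for t
    define F where "F t x =
      x $ 0 * x $ 1 * (q2 x * x $ 4 + t ^ 3 * q1 x * (x $ 4)^2 + t ^ 6 * e * (x $ 4)^3)" for t x
    have "F 0 \<in> closure (SL5_orbit f)"
    proof (rule torus_limit)
      show "(\<Prod>i\<in>UNIV. w t $ i) = 1" if "t \<noteq> 0" for t
        using that by (simp add: w_def prod_5 power2_eq_square)
      show "f (\<chi> i. w t $ i * x $ i) = F t x" if "t \<noteq> 0" for t x
        using that by (simp add: f F_def q2 q1 w_def eval_nat_numeral field_simps)
      show "isCont (\<lambda>t. F t x) 0" for x unfolding F_def by (intro continuous_intros)
    qed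
    then have lim: "(\<lambda>x. x $ 0 * x $ 1 * x $ 4 * q2 x) \<in> closure (SL5_orbit f)"
      by (simp add: F_def[abs_def] mult_ac)
    show ?thesis
    proof (rule MO2_degeneration[OF assms(2-4) _ lim])
      have "(\<lambda>x. x $ 4 * q2 x) \<in> forms UNIV 3"
        by (rule forms_mult'[OF forms_coord forms_mono[OF qs(1)]]) simp_all
      then show "(\<lambda>x. x $ 0 * x $ 1 * x $ 4 * q2 x) \<in> quintics"
        using quintic_from_ternary by (simp add: mult.assoc)
      show "of_type MO2_IV (\<lambda>x. x $ 0 * x $ 1 * x $ 4 * q2 x)"
        by (rule of_type_self) (use qs(1) in \<open>auto simp: MO2_IV_def\<close>)
      obtain y where "q2 y \<noteq> 0" using False by auto
      moreover have "q2 (vec5 1 1 (y $ 2) (y $ 3) 1) = q2 y" by (simp add: q2)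
      ultimately show "(\<lambda>x. x $ 0 * x $ 1 * x $ 4 * q2 x) \<noteq> (\<lambda>_. 0)"
        by (auto simp: fun_eq_iff intro!: exI[of _ "vec5 1 1 (y $ 2) (y $ 3) 1"])
    qed
  next
    case True
    \<comment> \<open>A double line times a further line: \<open>f\<close> itself is of type MO2-IV
      unless the lines coincide, and that case is exceptional.\<close>
    then have f: "f = (\<lambda>x. x $ 0 * x $ 1 * ((\<alpha> * x $ 2 + \<beta> * x $ 3 + e * x $ 4) * (x $ 4)^2))"
      by (simp add: f q1 fun_eq_iff algebra_simps power2_eq_square power3_eq_cube)
    have MO2: "(\<lambda>x. x $ 0 * x $ 1 * (x $ 4 * (x $ 3)^2)) \<in> MO2_IV"
      unfolding MO2_IV_def
      by (intro CollectI exI[of _ "\<lambda>x. (x $ 3)^2"]) (auto simp: mult.assoc intro: forms_coord_power)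
    have "of_type MO2_IV f"
    proof -
      consider "\<alpha> \<noteq> 0" | "\<alpha> = 0" "\<beta> \<noteq> 0" | "\<alpha> = 0" "\<beta> = 0" by blast
      then show ?thesis
      proof cases
        case 1
        show ?thesis
        proof (rule of_type_ternary_substitution)
          show "(\<lambda>x. 1 / \<alpha> * x $ 4 + (- \<beta>) / \<alpha> * x $ 2 + (- e) / \<alpha> * x $ 3) \<in> forms UNIV (Suc 0)"
            "(\<lambda>x. x $ 2) \<in> forms UNIV (Suc 0)" "(\<lambda>x. x $ 3) \<in> forms UNIV (Suc 0)"
            by (rule linear_forms_UNIV)+
          show "(\<lambda>x. f (vec5 (x $ 0) (x $ 1) (1 / \<alpha> * x $ 4 + (- \<beta>) / \<alpha> * x $ 2 + (- e) / \<alpha> * x $ 3)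
              (x $ 2) (x $ 3))) \<in> MO2_IV"
            using MO2 1 by (simp add: f field_simps)
        qed (use 1 in auto)
      next
        case 2
        show ?thesis
        proof (rule of_type_ternary_substitution)
          show "(\<lambda>x. x $ 2) \<in> forms UNIV (Suc 0)"
            "(\<lambda>x. 1 / \<beta> * x $ 4 + (- e) / \<beta> * x $ 3) \<in> forms UNIV (Suc 0)"
            "(\<lambda>x. x $ 3) \<in> forms UNIV (Suc 0)" by (rule linear_forms_UNIV)+
          show "(\<lambda>x. f (vec5 (x $ 0) (x $ 1) (x $ 2) (1 / \<beta> * x $ 4 + (- e) / \<beta> * x $ 3) (x $ 3))) \<in> MO2_IV"
            using MO2 2 by (simp add: f field_simps)
        qed (use 2 in auto)
      next
        case 3
        then have "f \<in> triple_hyperplane"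
          by (auto simp: f triple_hyperplane_def fun_eq_iff power2_eq_square power3_eq_cube intro!: exI[of _ e])
        then show ?thesis using assms(4) of_type_self by (simp add: exceptional_def)
      qed
    qed
    moreover have "f \<in> SL5_orbit f"
      by (auto simp: SL5_orbit_def change_coords_def intro!: exI[of _ "mat 1"])
    ultimately show ?thesis
      using closure_subset assms by (intro MO2_degeneration[of f f]) auto
  qed
qed

lemma SS2_scale: "h \<in> SS2_VIII \<Longrightarrow> (\<lambda>x. k * h x) \<in> SS2_VIII"
proof -
  assume "h \<in> SS2_VIII"
  then obtain q2 q1 c where q: "q2 \<in> forms {2, 3} 2" "q1 \<in> forms {2, 3} 1"
    "h = (\<lambda>x. x $ 0 * x $ 1 * (q2 x * x $ 4 + q1 x * (x $ 4)^2 + c * (x $ 4)^3))"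
    unfolding SS2_VIII_def by blast
  then have "(\<lambda>x. k * h x) = (\<lambda>x. x $ 0 * x $ 1 *
      ((\<lambda>x. k * q2 x) x * x $ 4 + (\<lambda>x. k * q1 x) x * (x $ 4)^2 + (k * c) * (x $ 4)^3))"
    by (simp add: algebra_simps)
  with forms_scale[OF q(1), of k] forms_scale[OF q(2), of k] show ?thesis unfolding SS2_VIII_def
    by (intro CollectI exI[of _ "\<lambda>x. k * q2 x"] exI[of _ "\<lambda>x. k * q1 x"] exI[of _ "k * c"] conjI)
qed

lemma SS1_scale: "h \<in> SS1_VIII \<Longrightarrow> (\<lambda>x. k * h x) \<in> SS1_VIII"
proof -
  assume "h \<in> SS1_VIII"
  then obtain q2 q3 where q: "q2 \<in> forms {3, 4} 2" "q3 \<in> forms {3, 4} 3"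
    "h = (\<lambda>x. x $ 0 * x $ 1 * (x $ 2 * q2 x + q3 x))" unfolding SS1_VIII_def by blast
  then have "(\<lambda>x. k * h x) = (\<lambda>x. x $ 0 * x $ 1 * (x $ 2 * (\<lambda>x. k * q2 x) x + (\<lambda>x. k * q3 x) x))"
    by (simp add: algebra_simps)
  with forms_scale[OF q(1), of k] forms_scale[OF q(2), of k] show ?thesis unfolding SS1_VIII_def
    by (intro CollectI exI[of _ "\<lambda>x. k * q2 x"] exI[of _ "\<lambda>x. k * q3 x"] conjI)
qed

lemma SS2_degeneration:
  assumes "of_type SS2_VIII f" "f \<in> quintics" "f \<noteq> (\<lambda>_. 0)" "\<not> exceptional f"
  shows "\<not> closed_orbit f \<and> degenerates_to MO2_IV f"
proof -
  obtain s where s: "det s = 1" "change_coords s f \<in> SS2_VIII"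
    using of_type_SL5E[OF assms(1,2) SS2_scale] by blast
  have "change_coords s f \<in> quintics" "change_coords s f \<noteq> (\<lambda>_. 0)" "\<not> exceptional (change_coords s f)"
    using assms(2-4) change_coords_eq_0[OF s(1)] exceptional_change_coords[OF s(1)]
    by (auto simp: change_coords_def forms_change_coords)
  from degeneration_change_coords[OF s(1) SS2_form_degeneration[OF s(2) this]] show ?thesis .
qed

text \<open>A cubic in two variables has a linear factor, and SS2-VIII asks just for divisibility by
  \<open>x4\<close>. If \<open>a = 0\<close> this holds already; otherwise a root \<open>r\<close>
  gives the factor \<open>x3 - r * x4\<close>, which becomes the new \<open>x4\<close>.\<close>

lemma binary_cubic_SS2:
  assumes "q \<in> forms {3, 4} 3"
  shows "of_type SS2_VIII (\<lambda>x. x $ 0 * x $ 1 * q x)"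
proof -
  obtain a b c d where q:
    "q = (\<lambda>x. a * (x $ 3)^3 + b * (x $ 3)^2 * x $ 4 + c * x $ 3 * (x $ 4)^2 + d * (x $ 4)^3)"
    using assms by (rule binary_cubic)
  have SS2: "(\<lambda>x. x $ 0 * x $ 1 * (a' * (x $ 3)^2 * x $ 4 + b' * x $ 3 * (x $ 4)^2 + c' * (x $ 4)^3)) \<in> SS2_VIII"
    for a' b' c'
    unfolding SS2_VIII_def
    by (intro CollectI exI[of _ "\<lambda>x. a' * (x $ 3)^2"] exI[of _ "\<lambda>x. b' * x $ 3"] exI[of _ c'])
      (auto intro: forms_scale forms_coord forms_coord_power)
  show ?thesis
  proof (cases "a = 0")
    case True
    then show ?thesis using SS2[of b c d] by (intro of_type_self) (simp add: q)
  next
    case False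
    then have "\<not> constant (poly [:d, c, b, a:])" by (simp add: constant_degree)
    then obtain r where "poly [:d, c, b, a:] r = 0" using fundamental_theorem_of_algebra by blast
    then have d: "d = - (a * r^3 + b * r^2 + c * r)"
      by (simp add: algebra_simps power2_eq_square power3_eq_cube eq_neg_iff_add_eq_0)
    show ?thesis
    proof (rule of_type_ternary_substitution)
      show "(\<lambda>x. x $ 2) \<in> forms UNIV (Suc 0)" "(\<lambda>x. 1 * x $ 4 + r * x $ 3) \<in> forms UNIV (Suc 0)"
        "(\<lambda>x. x $ 3) \<in> forms UNIV (Suc 0)" by (rule linear_forms_UNIV)+
      have "q (vec5 (x $ 0) (x $ 1) (x $ 2) (1 * x $ 4 + r * x $ 3) (x $ 3)) =
          (3 * a * r^2 + 2 * b * r + c) * (x $ 3)^2 * x $ 4 + (3 * a * r + b) * x $ 3 * (x $ 4)^2 + a * (x $ 4)^3" for x :: cpoint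
        unfolding q d vec5_nth by (simp add: algebra_simps power2_eq_square power3_eq_cube)
      then show "(\<lambda>x. vec5 (x $ 0) (x $ 1) (x $ 2) (1 * x $ 4 + r * x $ 3) (x $ 3) $ 0 *
          vec5 (x $ 0) (x $ 1) (x $ 2) (1 * x $ 4 + r * x $ 3) (x $ 3) $ 1 *
          q (vec5 (x $ 0) (x $ 1) (x $ 2) (1 * x $ 4 + r * x $ 3) (x $ 3))) \<in> SS2_VIII"
        using SS2 by (simp only: vec5_nth)
    qed auto
  qed
qed

lemma SS1_form_degeneration:
  assumes "f \<in> SS1_VIII" "f \<in> quintics" "f \<noteq> (\<lambda>_. 0)" "\<not> exceptional f"
  shows "\<not> closed_orbit f \<and> degenerates_to MO2_IV f"
proof -
  from assms(1) obtain q2 q3 where qs: "q2 \<in> forms {3, 4} 2" "q3 \<in> forms {3, 4} 3"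
    and f: "f = (\<lambda>x. x $ 0 * x $ 1 * (x $ 2 * q2 x + q3 x))"
    unfolding SS1_VIII_def by blast
  show ?thesis
  proof (cases "q2 = (\<lambda>_. 0)")
    case True
    then show ?thesis using binary_cubic_SS2[OF qs(2)] assms by (intro SS2_degeneration) (simp_all add: f)
  next
    case False
    \<comment> \<open>Weights (0, 0, -2, 1, 1) fix \<open>x2 * q2\<close> and give \<open>q3\<close>
      weight 3.\<close>
    define w :: "complex \<Rightarrow> cpoint" where "w t = vec5 1 1 (1 / t ^ 2) t t" for t
    define F where "F t x = x $ 0 * x $ 1 * (x $ 2 * q2 x + t ^ 3 * q3 x)" for t x
    have "F 0 \<in> closure (SL5_orbit f)"
    proof (rule torus_limit)
      show "(\<Prod>i\<in>UNIV. w t $ i) = 1" if "t \<noteq> 0" for t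
        using that by (simp add: w_def prod_5 power2_eq_square)
      show "f (\<chi> i. w t $ i * x $ i) = F t x" if "t \<noteq> 0" for t x
      proof -
        have "q2 (\<chi> i. w t $ i * x $ i) = q2 (t *s x)" "q3 (\<chi> i. w t $ i * x $ i) = q3 (t *s x)"
          by (rule forms_cong_coords[OF qs(1)] forms_cong_coords[OF qs(2)]; auto simp: w_def)+
        then show ?thesis
          using that by (simp add: f F_def w_def forms_homogeneous[OF qs(1)] forms_homogeneous[OF qs(2)])
      qed
      show "isCont (\<lambda>t. F t x) 0" for x unfolding F_def by (intro continuous_intros)
    qed
    then have lim: "(\<lambda>x. x $ 0 * x $ 1 * (x $ 2 * q2 x)) \<in> closure (SL5_orbit f)"
      by (simp add: F_def[abs_def])
    show ?thesis
    proof (rule MO2_degeneration[OF assms(2-4) _ lim])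
      have "(\<lambda>x. x $ 2 * q2 x) \<in> forms UNIV 3"
        by (rule forms_mult'[OF forms_coord forms_mono[OF qs(1)]]) simp_all
      then show "(\<lambda>x. x $ 0 * x $ 1 * (x $ 2 * q2 x)) \<in> quintics" by (rule quintic_from_ternary)
      show "of_type MO2_IV (\<lambda>x. x $ 0 * x $ 1 * (x $ 2 * q2 x))"
      proof (rule of_type_ternary_substitution)
        show "(\<lambda>x. x $ 4) \<in> forms UNIV (Suc 0)" "(\<lambda>x. x $ 2) \<in> forms UNIV (Suc 0)"
          "(\<lambda>x. x $ 3) \<in> forms UNIV (Suc 0)" by (rule linear_forms_UNIV)+
        have "(\<lambda>x. q2 (vec5 (x $ 0) (x $ 1) (x $ 4) (x $ 2) (x $ 3))) \<in> forms {2, 3} 2"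
          by (rule forms_subst[OF qs(1)]) (auto intro: forms_coord)
        then show "(\<lambda>x. vec5 (x $ 0) (x $ 1) (x $ 4) (x $ 2) (x $ 3) $ 0 *
            vec5 (x $ 0) (x $ 1) (x $ 4) (x $ 2) (x $ 3) $ 1 *
            (vec5 (x $ 0) (x $ 1) (x $ 4) (x $ 2) (x $ 3) $ 2 *
              q2 (vec5 (x $ 0) (x $ 1) (x $ 4) (x $ 2) (x $ 3)))) \<in> MO2_IV"
          unfolding MO2_IV_def by (auto simp: mult.assoc)
      qed auto
      obtain y where "q2 y \<noteq> 0" using False by auto
      moreover have "q2 (vec5 1 1 1 (y $ 3) (y $ 4)) = q2 y"
        by (rule forms_cong_coords[OF qs(1)]) auto
      ultimately show "(\<lambda>x. x $ 0 * x $ 1 * (x $ 2 * q2 x)) \<noteq> (\<lambda>_. 0)"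
        by (auto simp: fun_eq_iff intro!: exI[of _ "vec5 1 1 1 (y $ 3) (y $ 4)"])
    qed
  qed
qed

lemma SS1_degeneration:
  assumes "of_type SS1_VIII f" "f \<in> quintics" "f \<noteq> (\<lambda>_. 0)" "\<not> exceptional f"
  shows "\<not> closed_orbit f \<and> degenerates_to MO2_IV f"
proof -
  obtain s where s: "det s = 1" "change_coords s f \<in> SS1_VIII"
    using of_type_SL5E[OF assms(1,2) SS1_scale] by blast
  have "change_coords s f \<in> quintics" "change_coords s f \<noteq> (\<lambda>_. 0)" "\<not> exceptional (change_coords s f)"
    using assms(2-4) change_coords_eq_0[OF s(1)] exceptional_change_coords[OF s(1)]
    by (auto simp: change_coords_def forms_change_coords)
  from degeneration_change_coords[OF s(1) SS1_form_degeneration[OF s(2) this]] show ?thesis .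
qed

text \<open>A triple hyperplane belongs to US1-VIII, so only five hyperplanes are left, with a
  nonzero coefficient because \<open>f\<close> is nonzero.\<close>

lemma exceptional_closed:
  assumes "exceptional f" "f \<in> quintics" "f \<noteq> (\<lambda>_. 0)" "\<not> of_type US1_VIII f"
  shows "closed_orbit f"
proof -
  have "triple_hyperplane \<subseteq> US1_VIII"
  proof
    fix h assume "h \<in> triple_hyperplane"
    then obtain c where h: "h = (\<lambda>x. c * (x $ 0 * x $ 1 * (x $ 4)^3))" unfolding triple_hyperplane_def by blast
    show "h \<in> US1_VIII" unfolding US1_VIII_def
      by (intro CollectI exI[of _ "\<lambda>x. c * (x $ 4)^3"] exI[of _ 0])
        (auto simp: h intro: forms_scale forms_coord_power)
  qed
  then have "of_type five_hyperplanes f"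
    using assms(1,4) unfolding exceptional_def of_type_def by blast
  then obtain s where s: "det s = 1" "change_coords s f \<in> five_hyperplanes"
    using assms(2)
  proof (rule of_type_SL5E)
    fix k and h assume "h \<in> five_hyperplanes"
    then show "(\<lambda>x. k * h x) \<in> five_hyperplanes"
      unfolding five_hyperplanes_def by (force simp: mult.assoc[symmetric])
  qed
  then obtain c where c: "change_coords s f = (\<lambda>x. c * (x $ 0 * x $ 1 * x $ 2 * x $ 3 * x $ 4))"
    unfolding five_hyperplanes_def by blast
  have "c \<noteq> 0"
  proof
    assume "c = 0"
    then have "change_coords s f = (\<lambda>_. 0)" by (simp add: c)
    then show False using change_coords_eq_0[OF s(1)] assms(3) by blast
  qed
  then have "closed_orbit (change_coords s f)" unfolding c by (rule closed_orbit_five_hyperplanes)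
  then show ?thesis by (simp only: closed_orbit_change_coords[OF s(1)])
qed

text \<open>A nontrivial zero of the gradient would put \<open>f\<close> into SS1-VIII, so the cubic
  is smooth.\<close>

lemma closed_if_not_singular:
  assumes "of_type two_hyperplanes_and_cubic f" "f \<in> quintics" "\<not> of_type SS1_VIII f"
  shows "closed_orbit f"
proof -
  obtain s where s: "det s = 1" "change_coords s f \<in> two_hyperplanes_and_cubic"
    using assms(1,2)
  proof (rule of_type_SL5E)
    fix k and h assume "h \<in> two_hyperplanes_and_cubic"
    then obtain q where q: "q \<in> forms {2, 3, 4} 3" "h = (\<lambda>x. x $ 0 * x $ 1 * q x)"
      unfolding two_hyperplanes_and_cubic_def by blast
    then have "(\<lambda>x. k * h x) = (\<lambda>x. x $ 0 * x $ 1 * (\<lambda>x. k * q x) x)" by (simp add: algebra_simps)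
    with forms_scale[OF q(1), of k] show "(\<lambda>x. k * h x) \<in> two_hyperplanes_and_cubic"
      unfolding two_hyperplanes_and_cubic_def by (intro CollectI exI[of _ "\<lambda>x. k * q x"] conjI)
  qed
  then obtain q where q: "q \<in> forms {2, 3, 4} 3" "change_coords s f = (\<lambda>x. x $ 0 * x $ 1 * q x)"
    unfolding two_hyperplanes_and_cubic_def by blast
  obtain G where G: "polar_of q G" using q(1) by (rule ternary_cubic_polar)
  have "null3 p" if "null3 (G p)" for p
  proof (rule ccontr)
    assume "\<not> null3 p"
    then have "of_type SS1_VIII (change_coords s f)"
      using singular_cubic_SS1[OF q(1) G that] by (simp add: q(2))
    moreover have "invertible s" using s(1) by (simp add: invertible_det_nz)
    ultimately show False using of_type_change_coords assms(3) by blast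
  qed
  then have "closed_orbit (change_coords s f)"
    unfolding q(2) by (intro closed_orbit_smooth_cubic[OF q(1) G])
  then show ?thesis by (simp add: closed_orbit_change_coords[OF s(1)])
qed

theorem proposition35:
  fixes f :: "complex ^ 5 \<Rightarrow> complex"
  assumes "f \<in> quintics" and "f \<noteq> (\<lambda>_. 0)"
    and "of_type two_hyperplanes_and_cubic f"
  shows "(of_type US1_VIII f \<longrightarrow> unstable f) \<and>
    (of_type SS1_VIII f \<and> \<not> exceptional f \<longrightarrow> \<not> closed_orbit f \<and> degenerates_to MO2_IV f) \<and>
    (of_type SS2_VIII f \<and> \<not> exceptional f \<longrightarrow> \<not> closed_orbit f \<and> degenerates_to MO2_IV f) \<and>
    (\<not> of_type US1_VIII f \<and>
     \<not> (of_type SS1_VIII f \<and> \<not> exceptional f) \<and>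
     \<not> (of_type SS2_VIII f \<and> \<not> exceptional f) \<longrightarrow> closed_orbit f)"
  \<comment> \<open>In the last clause \<open>f\<close> is either not of type SS1-VIII, hence
    smooth, or of that type and exceptional.\<close>
  using US1_unstable(1)[OF _ assms(1)] SS1_degeneration[OF _ assms(1,2)]
    SS2_degeneration[OF _ assms(1,2)] exceptional_closed[OF _ assms(1,2)]
    closed_if_not_singular[OF assms(3,1)] by blast

end
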